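(* Let $X$ be a compact Hausdorff space and $A$ a Banach algebra. If $A$ has a central compactly approximate diagonal, then $C(X,A)$ has a compactly approximate diagonal.
   Context: Banach algebras are complex. $C(X,A)$ denotes the Banach algebra of all continuous functions $f: X\to A$ with pointwise algebraic operations and norm $\|f\|_\infty=\sup\{\|f(x)\|_A : x\in X\}$. For a Banach algebra $B$, $B\hat{\otimes}B$ is the Banach space projective tensor product, i.e. the completion of $B\otimes B$ in the norm $\|u\|_p = \inf\{\sum_{i=1}^n \|a_i\|\|b_i\| : u=\sum_{i=1}^n a_i\otimes b_i\}$. It is a Banach $B$-bimodule via $a\cdot(b\otimes c)=ab\otimes c$ and $(b\otimes c)\cdot a=b\otimes ca$. Let $\pi: B\hat{\otimes}B\to B$ be the product map, the bounded linear map determined by $\pi(a\otimes b)=ab$. A net $(u_\nu)\subset B\hat{\otimes}B$ (not necessarily bounded) is an approximate diagonal for $B$ if $a\cdot u_\nu-u_\nu\cdot a\to 0$ and $\pi(u_\nu)a\to a$ in norm for all $a\in B$. It is central if $a\cdot u_\nu=u_\nu\cdot a$ for all $a\in B$ and all $\nu$. It is a compactly approximate diagonal for $B$ if for each compact set $K\subset B$ and any $\varepsilon>0$ there is $\nu_0$ such that $\|a\cdot u_\nu-u_\nu\cdot a\|_p<\varepsilon$ and $\|\pi(u_\nu)a-a\|<\varepsilon$ for all $a\in K$ whenever $\nu\geq\nu_0$. A central compactly approximate diagonal is a compactly approximate diagonal that is central. *)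

theory Defs
  imports "HOL-Analysis.Analysis"
begin

section \<open>Complex Banach algebras\<close>

class scaleC =
  fixes scaleC :: "complex \<Rightarrow> 'a \<Rightarrow> 'a" (infixr "*\<^sub>C" 75)

class complex_vector = real_vector + scaleC +
  assumes scaleC_add_right: "c *\<^sub>C (x + y) = c *\<^sub>C x + c *\<^sub>C y"
    and scaleC_add_left: "(c + d) *\<^sub>C x = c *\<^sub>C x + d *\<^sub>C x"
    and scaleC_scaleC: "c *\<^sub>C (d *\<^sub>C x) = (c * d) *\<^sub>C x"
    and scaleR_scaleC: "r *\<^sub>R x = complex_of_real r *\<^sub>C x"
begin

lemma scaleC_one: "1 *\<^sub>C x = x"
  using scaleR_scaleC[of 1 x] scaleR_one by simp

lemma scaleC_zero_right: "c *\<^sub>C 0 = 0"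
  using scaleC_add_right[of c 0 0] by simp

lemma scaleC_minus_right: "c *\<^sub>C (- x) = - (c *\<^sub>C x)"
  using scaleC_add_right[of c x "- x"] scaleC_zero_right by (simp add: eq_neg_iff_add_eq_0 add_commute)

lemma scaleC_diff_right: "c *\<^sub>C (x - y) = c *\<^sub>C x - c *\<^sub>C y"
  using scaleC_add_right[of c x "- y"] scaleC_minus_right[of c y] by simp

end

class complex_normed_vector = complex_vector + real_normed_vector +
  assumes norm_scaleC: "norm (c *\<^sub>C x) = cmod c * norm x"

lemma bounded_linear_scaleC: "bounded_linear (\<lambda>x::'a::complex_normed_vector. c *\<^sub>C x)"
  by (rule bounded_linear_intro[of _ "cmod c"])
    (simp_all add: scaleC_add_right norm_scaleC scaleR_scaleC scaleC_scaleC mult.commute)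

text \<open>No unit is assumed: the library class \<^class>\<open>real_normed_algebra\<close> only asks for a
  submultiplicative norm.\<close>

class complex_banach_algebra = complex_normed_vector + real_normed_algebra + banach +
  assumes mult_scaleC_left: "(c *\<^sub>C x) * y = c *\<^sub>C (x * y)"
    and mult_scaleC_right: "x * (c *\<^sub>C y) = c *\<^sub>C (x * y)"


section \<open>The Banach algebra of continuous functions\<close>

text \<open>On a compact space every continuous function is bounded, so the library type of bounded
  continuous functions with its supremum norm is the space of all continuous functions.\<close>

lemma bcontfun_compact:
  assumes "compact (UNIV :: 'x::topological_space set)"
  shows "(bcontfun :: ('x \<Rightarrow> 'a::metric_space) set) = {f. continuous_on UNIV f}"
  using assms by (auto simp: bcontfun_def intro: compact_imp_bounded compact_continuous_image)

lemma norm_bcontfun_SUP: "norm f = (SUP x. norm (apply_bcontfun f x))"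
  by (simp add: norm_bcontfun_def dist_bcontfun.rep_eq)

text \<open>The library proves completeness only for metric domains.\<close>

instance bcontfun :: (topological_space, complete_space) complete_space
proof
  fix f :: "nat \<Rightarrow> ('a, 'b) bcontfun"
  assume "Cauchy f"
  then obtain g where g: "uniform_limit UNIV (\<lambda>n. apply_bcontfun (f n)) g sequentially"
    using uniformly_convergent_eq_cauchy[of "\<lambda>_. True" "\<lambda>n. apply_bcontfun (f n)"]
    unfolding Cauchy_def uniform_limit_sequentially_iff
    by (metis dist_fun_lt_imp_dist_val_lt)
  from uniform_limit_bcontfunE[OF this sequentially_bot]
  obtain l' where "g = apply_bcontfun l'" "f \<longlonglongrightarrow> l'" by metis
  then show "convergent f" by (auto simp: convergent_def)
qed

instance bcontfun :: (topological_space, banach) banach ..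

setup_lifting type_definition_bcontfun

instantiation bcontfun :: (topological_space, complex_banach_algebra) complex_banach_algebra
begin

lift_definition times_bcontfun :: "('a \<Rightarrow>\<^sub>C 'b) \<Rightarrow> ('a \<Rightarrow>\<^sub>C 'b) \<Rightarrow> 'a \<Rightarrow>\<^sub>C 'b"
  is "\<lambda>f g x. f x * g x"
proof -
  fix f g :: "'a \<Rightarrow> 'b" assume "f \<in> bcontfun" "g \<in> bcontfun"
  then obtain M N where "continuous_on UNIV f" "continuous_on UNIV g"
    and M: "\<And>x. norm (f x) \<le> M" and N: "\<And>x. norm (g x) \<le> N"
    by (auto simp: bcontfun_def bounded_iff)
  have "norm (f x * g x) \<le> M * N" for x
    by (rule order_trans[OF norm_mult_ineq]) (metis M N mult_mono norm_ge_zero order_trans)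
  with \<open>continuous_on UNIV f\<close> \<open>continuous_on UNIV g\<close> show "(\<lambda>x. f x * g x) \<in> bcontfun"
    by (intro bcontfun_normI continuous_intros)
qed

lift_definition scaleC_bcontfun :: "complex \<Rightarrow> ('a \<Rightarrow>\<^sub>C 'b) \<Rightarrow> 'a \<Rightarrow>\<^sub>C 'b"
  is "\<lambda>c f x. c *\<^sub>C f x"
proof -
  fix c and f :: "'a \<Rightarrow> 'b" assume f: "f \<in> bcontfun"
  have "bounded_linear (\<lambda>y::'b. c *\<^sub>C y)" by (rule bounded_linear_scaleC)
  with f show "(\<lambda>x. c *\<^sub>C f x) \<in> bcontfun"
    unfolding bcontfun_def
    by (auto intro: bounded_linear.continuous_on
        simp: bounded_linear_image[of "range f", unfolded image_image])
qed

instance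
proof
  fix f g h :: "'a \<Rightarrow>\<^sub>C 'b" and c d :: complex and r :: real
  note [simp] = times_bcontfun.rep_eq scaleC_bcontfun.rep_eq
  show "f * g * h = f * (g * h)" "(f + g) * h = f * h + g * h" "f * (g + h) = f * g + f * h"
    "r *\<^sub>R f * g = r *\<^sub>R (f * g)" "f * r *\<^sub>R g = r *\<^sub>R (f * g)"
    by (auto intro!: bcontfun_eqI simp: algebra_simps)
  show "c *\<^sub>C (f + g) = c *\<^sub>C f + c *\<^sub>C g" "(c + d) *\<^sub>C f = c *\<^sub>C f + d *\<^sub>C f"
    "c *\<^sub>C d *\<^sub>C f = (c * d) *\<^sub>C f" "r *\<^sub>R f = complex_of_real r *\<^sub>C f"
    "c *\<^sub>C f * g = c *\<^sub>C (f * g)" "f * c *\<^sub>C g = c *\<^sub>C (f * g)"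
    by (auto intro!: bcontfun_eqI simp: scaleC_add_right scaleC_add_left scaleC_scaleC
        scaleR_scaleC mult_scaleC_left mult_scaleC_right)
  show "norm (f * g) \<le> norm f * norm g"
  proof (rule norm_bound)
    fix x show "norm (apply_bcontfun (f * g) x) \<le> norm f * norm g"
      by simp (rule order_trans[OF norm_mult_ineq], intro mult_mono norm_bounded norm_ge_zero)
  qed
  have le: "norm (e *\<^sub>C u) \<le> cmod e * norm u" for e and u :: "'a \<Rightarrow>\<^sub>C 'b"
    by (rule norm_bound) (simp add: norm_scaleC mult_left_mono norm_bounded)
  show "norm (c *\<^sub>C f) = cmod c * norm f"
  proof (cases "c = 0")
    case True
    then show ?thesis using le[of 0 f] by simp
  next
    case False
    have eq: "inverse c *\<^sub>C c *\<^sub>C f = f"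
      using False by (auto intro!: bcontfun_eqI simp: scaleC_scaleC scaleC_one)
    have "norm f \<le> cmod (inverse c) * norm (c *\<^sub>C f)"
      using le[of "inverse c" "c *\<^sub>C f"] unfolding eq .
    then have "cmod c * norm f \<le> norm (c *\<^sub>C f)"
      using False by (simp add: norm_inverse norm_divide field_simps)
    with le[of c f] show ?thesis by simp
  qed
qed

end


section \<open>The algebraic tensor product\<close>

text \<open>A list \<open>[(a\<^sub>1, b\<^sub>1), \<dots>, (a\<^sub>n, b\<^sub>n)]\<close> is a formal sum
  \<open>a\<^sub>1 \<otimes> b\<^sub>1 + \<dots> + a\<^sub>n \<otimes> b\<^sub>n\<close>; the relation is the least congruence that makes addition
  (concatenation) commutative and \<open>\<otimes>\<close> bilinear over the complex numbers.\<close>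

inductive tensor_rel ::
  "('a::complex_vector \<times> 'b::complex_vector) list \<Rightarrow> ('a \<times> 'b) list \<Rightarrow> bool" where
  refl: "tensor_rel xs xs"
| sym: "tensor_rel xs ys \<Longrightarrow> tensor_rel ys xs"
| trans: "tensor_rel xs ys \<Longrightarrow> tensor_rel ys zs \<Longrightarrow> tensor_rel xs zs"
| append: "tensor_rel xs xs' \<Longrightarrow> tensor_rel ys ys' \<Longrightarrow> tensor_rel (xs @ ys) (xs' @ ys')"
| commute: "tensor_rel (xs @ ys) (ys @ xs)"
| add_left: "tensor_rel [(a + a', b)] [(a, b), (a', b)]"
| add_right: "tensor_rel [(a, b + b')] [(a, b), (a, b')]"
| scale: "tensor_rel [(c *\<^sub>C a, b)] [(a, c *\<^sub>C b)]"
| zero: "tensor_rel [(0, b)] []"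

quotient_type (overloaded) ('a, 'b) tensor = "('a::complex_vector \<times> 'b::complex_vector) list" / tensor_rel
  by (rule equivpI) (auto intro!: reflpI sympI transpI intro: tensor_rel.refl tensor_rel.sym tensor_rel.trans)

lift_definition pure_tensor :: "'a::complex_vector \<Rightarrow> 'b::complex_vector \<Rightarrow> ('a, 'b) tensor"
  (infixr "\<otimes>\<^sub>t" 70) is "\<lambda>a b. [(a, b)]" .

lemma tensor_rel_map:
  assumes "tensor_rel xs ys"
    and add1: "\<And>a a' b. tensor_rel [f (a + a', b)] [f (a, b), f (a', b)]"
    and add2: "\<And>a b b'. tensor_rel [f (a, b + b')] [f (a, b), f (a, b')]"
    and scale: "\<And>c a b. tensor_rel [f (c *\<^sub>C a, b)] [f (a, c *\<^sub>C b)]"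
    and zero: "\<And>b. tensor_rel [f (0, b)] []"
  shows "tensor_rel (map f xs) (map f ys)"
  using assms(1) by induction (auto intro: add1 add2 scale zero tensor_rel.intros)

lemma tensor_rel_add_inverse: "tensor_rel (map (\<lambda>(a, b). (- a, b)) xs @ xs) []"
proof (induction xs)
  case Nil
  then show ?case by (simp add: tensor_rel.refl)
next
  case (Cons p xs)
  obtain a b where p: "p = (a, b)" by force
  let ?n = "map (\<lambda>(a, b). (- a, b)) xs"
  have "tensor_rel ([(- a, b)] @ (?n @ [(a, b)]) @ xs) ([(- a, b)] @ ([(a, b)] @ ?n) @ xs)"
    by (intro tensor_rel.append tensor_rel.refl tensor_rel.commute)
  moreover have "tensor_rel ([(- a, b), (a, b)] @ (?n @ xs)) ([] @ [])"
    by (intro tensor_rel.append Cons.IH) (metis ab_left_minus tensor_rel.add_left tensor_rel.sym tensor_rel.trans tensor_rel.zero)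
  ultimately show ?case using tensor_rel.trans by (fastforce simp: p)
qed

instantiation tensor :: (complex_vector, complex_vector) complex_vector
begin

lift_definition zero_tensor :: "('a, 'b) tensor" is "[]" .

lift_definition plus_tensor :: "('a, 'b) tensor \<Rightarrow> ('a, 'b) tensor \<Rightarrow> ('a, 'b) tensor" is "(@)"
  by (rule tensor_rel.append)

lift_definition scaleC_tensor :: "complex \<Rightarrow> ('a, 'b) tensor \<Rightarrow> ('a, 'b) tensor"
  is "\<lambda>c. map (\<lambda>(a, b). (c *\<^sub>C a, b))"
proof (erule tensor_rel_map)
  fix c d :: complex and a a' :: 'a and b b' :: 'b
  have "tensor_rel [((c * d) *\<^sub>C a, b)] [(c *\<^sub>C a, d *\<^sub>C b)]"
    using tensor_rel.scale[of d "c *\<^sub>C a" b] by (simp add: scaleC_scaleC mult.commute)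
  then show "tensor_rel [case (d *\<^sub>C a, b) of (a, b) \<Rightarrow> (c *\<^sub>C a, b)]
    [case (a, d *\<^sub>C b) of (a, b) \<Rightarrow> (c *\<^sub>C a, b)]"
    by (simp add: scaleC_scaleC)
qed (simp_all add: scaleC_add_right scaleC_zero_right tensor_rel.intros)

definition uminus_tensor :: "('a, 'b) tensor \<Rightarrow> ('a, 'b) tensor" where
  "uminus_tensor u = (- 1) *\<^sub>C u"

definition minus_tensor :: "('a, 'b) tensor \<Rightarrow> ('a, 'b) tensor \<Rightarrow> ('a, 'b) tensor" where
  "minus_tensor u v = u + (- v)"

definition scaleR_tensor :: "real \<Rightarrow> ('a, 'b) tensor \<Rightarrow> ('a, 'b) tensor" where
  "scaleR_tensor r u = complex_of_real r *\<^sub>C u"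

instance
proof
  fix u v w :: "('a, 'b) tensor" and c d :: complex and r s :: real
  show assoc: "u + v + w = u + (v + w)" by transfer (simp add: tensor_rel.refl)
  show comm: "u + v = v + u" by transfer (rule tensor_rel.commute)
  show "0 + u = u" by transfer (simp add: tensor_rel.refl)
  have [simp]: "(- 1) *\<^sub>C x = - x" for x :: 'a
    using scaleR_scaleC[of "- 1" x] by simp
  show "- u + u = 0"
    unfolding uminus_tensor_def by transfer (simp add: tensor_rel_add_inverse)
  show "u - v = u + - v" by (simp add: minus_tensor_def)
  have add_right: "e *\<^sub>C (x + y) = e *\<^sub>C x + e *\<^sub>C y" for e and x y :: "('a, 'b) tensor"
    by transfer (simp add: tensor_rel.refl)
  then show "c *\<^sub>C (u + v) = c *\<^sub>C u + c *\<^sub>C v" .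
  have add_left: "(e + f) *\<^sub>C x = e *\<^sub>C x + f *\<^sub>C x" for e f and x :: "('a, 'b) tensor"
  proof (transfer)
    fix e f and xs :: "('a \<times> 'b) list"
    show "tensor_rel (map (\<lambda>(a, b). ((e + f) *\<^sub>C a, b)) xs)
      (map (\<lambda>(a, b). (e *\<^sub>C a, b)) xs @ map (\<lambda>(a, b). (f *\<^sub>C a, b)) xs)"
    proof (induction xs)
      case Nil
      then show ?case by (simp add: tensor_rel.refl)
    next
      case (Cons p xs)
      obtain a b where p: "p = (a, b)" by force
      let ?E = "map (\<lambda>(a, b). (e *\<^sub>C a, b)) xs" and ?F = "map (\<lambda>(a, b). (f *\<^sub>C a, b)) xs"
      have "tensor_rel ([((e + f) *\<^sub>C a, b)] @ map (\<lambda>(a, b). ((e + f) *\<^sub>C a, b)) xs)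
        ([(e *\<^sub>C a, b), (f *\<^sub>C a, b)] @ (?E @ ?F))"
        by (intro tensor_rel.append Cons.IH) (simp add: scaleC_add_left tensor_rel.add_left)
      moreover have "tensor_rel ([(e *\<^sub>C a, b)] @ ([(f *\<^sub>C a, b)] @ ?E) @ ?F)
        ([(e *\<^sub>C a, b)] @ (?E @ [(f *\<^sub>C a, b)]) @ ?F)"
        by (intro tensor_rel.append tensor_rel.refl tensor_rel.commute)
      ultimately show ?case using tensor_rel.trans by (fastforce simp: p)
    qed
  qed
  show "(c + d) *\<^sub>C u = c *\<^sub>C u + d *\<^sub>C u" by (rule add_left)
  have scale: "e *\<^sub>C f *\<^sub>C x = (e * f) *\<^sub>C x" for e f and x :: "('a, 'b) tensor"
    by transfer (simp add: tensor_rel.refl scaleC_scaleC case_prod_unfold comp_def)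
  show "c *\<^sub>C d *\<^sub>C u = (c * d) *\<^sub>C u" by (rule scale)
  show "r *\<^sub>R u = complex_of_real r *\<^sub>C u" by (simp add: scaleR_tensor_def)
  show "r *\<^sub>R (u + v) = r *\<^sub>R u + r *\<^sub>R v" "(r + s) *\<^sub>R u = r *\<^sub>R u + s *\<^sub>R u"
    "r *\<^sub>R s *\<^sub>R u = (r * s) *\<^sub>R u"
    by (simp_all add: scaleR_tensor_def add_right add_left scale)
  show "1 *\<^sub>R u = u"
    unfolding scaleR_tensor_def
    by transfer (simp add: tensor_rel.refl scaleC_one case_prod_unfold)
qed

end

definition tensor_of_list :: "('a::complex_vector \<times> 'b::complex_vector) list \<Rightarrow> ('a, 'b) tensor" where
  "tensor_of_list xs = (\<Sum>(a, b)\<leftarrow>xs. a \<otimes>\<^sub>t b)"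

lemma tensor_of_list_abs: "tensor_of_list xs = abs_tensor xs"
proof (induction xs)
  case Nil
  then show ?case by (simp add: tensor_of_list_def zero_tensor_def)
next
  case (Cons p xs)
  then show ?case
    by (cases p) (simp add: tensor_of_list_def pure_tensor.abs_eq plus_tensor.abs_eq)
qed

lemma tensor_exhaust: "\<exists>xs. u = tensor_of_list xs"
  unfolding tensor_of_list_abs by (metis Quotient_abs_rep Quotient_tensor)

lemma tensor_of_list_append: "tensor_of_list (xs @ ys) = tensor_of_list xs + tensor_of_list ys"
  by (simp add: tensor_of_list_def)

lemma pure_tensor_bilinear:
  "(a + a') \<otimes>\<^sub>t b = a \<otimes>\<^sub>t b + a' \<otimes>\<^sub>t b"
  "a \<otimes>\<^sub>t (b + b') = a \<otimes>\<^sub>t b + a \<otimes>\<^sub>t b'"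
  "(c *\<^sub>C a) \<otimes>\<^sub>t b = c *\<^sub>C (a \<otimes>\<^sub>t b)"
  "a \<otimes>\<^sub>t (c *\<^sub>C b) = c *\<^sub>C (a \<otimes>\<^sub>t b)"
proof -
  show "(a + a') \<otimes>\<^sub>t b = a \<otimes>\<^sub>t b + a' \<otimes>\<^sub>t b"
    by transfer (simp add: tensor_rel.add_left)
  show "a \<otimes>\<^sub>t (b + b') = a \<otimes>\<^sub>t b + a \<otimes>\<^sub>t b'"
    by transfer (simp add: tensor_rel.add_right)
  show "(c *\<^sub>C a) \<otimes>\<^sub>t b = c *\<^sub>C (a \<otimes>\<^sub>t b)"
    by transfer (simp add: tensor_rel.refl)
  show "a \<otimes>\<^sub>t (c *\<^sub>C b) = c *\<^sub>C (a \<otimes>\<^sub>t b)"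
    by transfer (simp add: tensor_rel.sym[OF tensor_rel.scale])
qed

subsection \<open>The projective norm\<close>

definition tcost :: "('a::complex_normed_vector \<times> 'b::complex_normed_vector) list \<Rightarrow> real" where
  "tcost xs = (\<Sum>(a, b)\<leftarrow>xs. norm a * norm b)"

definition pnorm :: "('a::complex_normed_vector, 'b::complex_normed_vector) tensor \<Rightarrow> real" where
  "pnorm u = Inf {tcost xs | xs. u = tensor_of_list xs}"

lemma tcost_nonneg: "0 \<le> tcost xs"
  unfolding tcost_def by (rule sum_list_nonneg) auto

lemma tcost_append: "tcost (xs @ ys) = tcost xs + tcost ys"
  by (simp add: tcost_def)

lemma pnorm_le: "pnorm (tensor_of_list xs) \<le> tcost xs"
  unfolding pnorm_def by (rule cInf_lower) (auto intro!: bdd_belowI[of _ 0] tcost_nonneg)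

lemma pnorm_approx:
  assumes "pnorm u < r"
  obtains xs where "u = tensor_of_list xs" "tcost xs < r"
proof -
  have "{tcost xs | xs. u = tensor_of_list xs} \<noteq> {}" using tensor_exhaust[of u] by auto
  from cInf_lessD[OF this] assms that show thesis unfolding pnorm_def by blast
qed

lemma pnorm_nonneg: "0 \<le> pnorm u"
  unfolding pnorm_def by (rule cInf_greatest) (use tensor_exhaust[of u] tcost_nonneg in auto)

lemma pnorm_bounded_map:
  assumes "0 \<le> K"
    and "\<And>xs. \<exists>ys. F (tensor_of_list xs) = tensor_of_list ys \<and> tcost ys \<le> K * tcost xs"
  shows "pnorm (F u) \<le> K * pnorm u"
proof (rule field_le_epsilon)
  fix e :: real assume "0 < e"
  have d: "0 < e / (K + 1)" using \<open>0 < e\<close> assms(1) by simp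
  then obtain xs where xs: "u = tensor_of_list xs" "tcost xs < pnorm u + e / (K + 1)"
    using pnorm_approx[of u "pnorm u + e / (K + 1)"] by auto
  obtain ys where ys: "F u = tensor_of_list ys" "tcost ys \<le> K * tcost xs"
    using assms(2)[of xs] xs(1) by auto
  have "pnorm (F u) \<le> K * tcost xs" using pnorm_le[of ys] ys by simp
  also have "\<dots> \<le> K * (pnorm u + e / (K + 1))"
    using xs(2) assms(1) by (intro mult_left_mono) auto
  also have "\<dots> \<le> K * pnorm u + e"
  proof -
    have "K * (e / (K + 1)) \<le> (K + 1) * (e / (K + 1))"
      using d by (intro mult_right_mono) auto
    also have "\<dots> = e" using assms(1) by simp
    finally show ?thesis by (simp add: distrib_left)
  qed
  finally show "pnorm (F u) \<le> K * pnorm u + e" .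
qed

lemma pnorm_triangle: "pnorm (u + v) \<le> pnorm u + pnorm v"
proof (rule field_le_epsilon)
  fix e :: real assume "0 < e"
  then have e: "pnorm u < pnorm u + e / 2" "pnorm v < pnorm v + e / 2" by simp_all
  obtain xs where "u = tensor_of_list xs" "tcost xs < pnorm u + e / 2"
    by (rule pnorm_approx[OF e(1)])
  moreover obtain ys where "v = tensor_of_list ys" "tcost ys < pnorm v + e / 2"
    by (rule pnorm_approx[OF e(2)])
  ultimately show "pnorm (u + v) \<le> pnorm u + pnorm v + e"
    using pnorm_le[of "xs @ ys"] by (simp add: tensor_of_list_append tcost_append)
qed

lemma pnorm_zero: "pnorm 0 = 0"
proof (rule antisym)
  show "pnorm 0 \<le> 0" using pnorm_le[of "[]"] by (simp add: tensor_of_list_def tcost_def)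
qed (rule pnorm_nonneg)

lemma tcost_scale: "tcost (map (\<lambda>(a, b). (c *\<^sub>C a, b)) xs) = cmod c * tcost xs"
  by (induction xs) (auto simp: tcost_def norm_scaleC algebra_simps)

lemma pnorm_scaleC_le: "pnorm (c *\<^sub>C u) \<le> cmod c * pnorm u"
proof (rule pnorm_bounded_map)
  fix xs :: "('a \<times> 'b) list"
  show "\<exists>ys. c *\<^sub>C tensor_of_list xs = tensor_of_list ys \<and> tcost ys \<le> cmod c * tcost xs"
    by (intro exI[of _ "map (\<lambda>(a, b). (c *\<^sub>C a, b)) xs"])
      (simp add: tensor_of_list_abs scaleC_tensor.abs_eq tcost_scale)
qed simp

lemma pnorm_scaleC: "pnorm (c *\<^sub>C u) = cmod c * pnorm u"
proof (cases "c = 0")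
  case True
  then show ?thesis
    using pnorm_scaleC_le[of 0 u] pnorm_nonneg[of "0 *\<^sub>C u"] by simp
next
  case False
  have "inverse c *\<^sub>C c *\<^sub>C u = u"
    using False by (simp add: scaleC_scaleC scaleC_one)
  then have "pnorm u \<le> cmod (inverse c) * pnorm (c *\<^sub>C u)"
    using pnorm_scaleC_le[of "inverse c" "c *\<^sub>C u"] by simp
  then have "cmod c * pnorm u \<le> pnorm (c *\<^sub>C u)"
    using False by (simp add: norm_inverse norm_divide field_simps)
  with pnorm_scaleC_le[of c u] show ?thesis by simp
qed

lemma pnorm_minus: "pnorm (- u) = pnorm u"
  using pnorm_scaleC[of "- 1" u] by (simp add: uminus_tensor_def)

lemma pnorm_minus_commute: "pnorm (u - v) = pnorm (v - u)"
  using pnorm_minus[of "u - v"] by simp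

lemma pnorm_diff_triangle: "pnorm (u - w) \<le> pnorm (u - v) + pnorm (v - w)"
  using pnorm_triangle[of "u - v" "v - w"] by simp

lemma pnorm_abs_diff: "\<bar>pnorm u - pnorm v\<bar> \<le> pnorm (u - v)"
  using pnorm_triangle[of "u - v" v] pnorm_triangle[of "v - u" u] pnorm_minus_commute[of u v]
  by simp

subsection \<open>Bimodule actions and product map on the algebraic tensor product\<close>

lift_definition tensor_lmult ::
  "'b::complex_banach_algebra \<Rightarrow> ('b, 'b) tensor \<Rightarrow> ('b, 'b) tensor"
  is "\<lambda>a. map (\<lambda>(b, c). (a * b, c))"
  by (erule tensor_rel_map) (simp_all add: distrib_left mult_scaleC_right tensor_rel.intros)

lift_definition tensor_rmult ::
  "('b, 'b) tensor \<Rightarrow> 'b::complex_banach_algebra \<Rightarrow> ('b, 'b) tensor"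
  is "\<lambda>xs a. map (\<lambda>(b, c). (b, c * a)) xs"
  by (erule tensor_rel_map) (simp_all add: distrib_right mult_scaleC_left tensor_rel.intros)

lift_definition tensor_prod :: "('b::complex_banach_algebra, 'b) tensor \<Rightarrow> 'b"
  is "\<lambda>xs. \<Sum>(b, c)\<leftarrow>xs. b * c"
  by (erule tensor_rel.induct)
    (simp_all add: distrib_left distrib_right mult_scaleC_left mult_scaleC_right add.commute)

lemma tensor_lmult_pure: "tensor_lmult a (b \<otimes>\<^sub>t c) = (a * b) \<otimes>\<^sub>t c"
  by transfer (simp add: tensor_rel.refl)

lemma tensor_rmult_pure: "tensor_rmult (b \<otimes>\<^sub>t c) a = b \<otimes>\<^sub>t (c * a)"
  by transfer (simp add: tensor_rel.refl)

lemma tensor_prod_pure: "tensor_prod (b \<otimes>\<^sub>t c) = b * c"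
  by transfer simp

lemma tensor_lmult_add: "tensor_lmult a (u + v) = tensor_lmult a u + tensor_lmult a v"
  by transfer (simp add: tensor_rel.refl)

lemma tensor_rmult_add: "tensor_rmult (u + v) a = tensor_rmult u a + tensor_rmult v a"
  by transfer (simp add: tensor_rel.refl)

lemma tensor_prod_add: "tensor_prod (u + v) = tensor_prod u + tensor_prod v"
  by transfer simp

lemma tensor_lmult_scaleC: "tensor_lmult a (c *\<^sub>C u) = c *\<^sub>C tensor_lmult a u"
  by transfer (simp add: tensor_rel.refl mult_scaleC_right case_prod_unfold comp_def)

lemma tensor_rmult_scaleC: "tensor_rmult (c *\<^sub>C u) a = c *\<^sub>C tensor_rmult u a"
  by transfer (simp add: tensor_rel.refl case_prod_unfold comp_def)

lemma tensor_prod_scaleC: "tensor_prod (c *\<^sub>C u) = c *\<^sub>C tensor_prod u"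
proof transfer
  fix c and xs :: "('a \<times> 'a) list"
  show "(\<Sum>(b, d)\<leftarrow>map (\<lambda>(a, b). (c *\<^sub>C a, b)) xs. b * d) = c *\<^sub>C (\<Sum>(b, d)\<leftarrow>xs. b * d)"
    by (induction xs) (auto simp: scaleC_zero_right scaleC_add_right mult_scaleC_left)
qed

lemma tensor_lmult_diff: "tensor_lmult a (u - v) = tensor_lmult a u - tensor_lmult a v"
  using tensor_lmult_add[of a "u - v" v] by simp

lemma tensor_rmult_diff: "tensor_rmult (u - v) a = tensor_rmult u a - tensor_rmult v a"
  using tensor_rmult_add[of "u - v" v a] by simp

lemma tensor_prod_diff: "tensor_prod (u - v) = tensor_prod u - tensor_prod v"
  using tensor_prod_add[of "u - v" v] by simp

lemma pnorm_lmult: "pnorm (tensor_lmult a u) \<le> norm a * pnorm u"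
proof (rule pnorm_bounded_map)
  fix xs :: "('a \<times> 'a) list"
  have "tcost (map (\<lambda>(b, c). (a * b, c)) xs) \<le> norm a * tcost xs"
  proof (induction xs)
    case (Cons p xs)
    have "norm (a * fst p) * norm (snd p) \<le> norm a * (norm (fst p) * norm (snd p))"
      using mult_right_mono[OF norm_mult_ineq[of a "fst p"] norm_ge_zero[of "snd p"]]
      by (simp add: mult.assoc)
    with Cons show ?case by (auto simp: tcost_def distrib_left case_prod_unfold)
  qed (simp add: tcost_def)
  then show "\<exists>ys. tensor_lmult a (tensor_of_list xs) = tensor_of_list ys \<and> tcost ys \<le> norm a * tcost xs"
    by (intro exI[of _ "map (\<lambda>(b, c). (a * b, c)) xs"])
      (simp add: tensor_of_list_abs tensor_lmult.abs_eq)
qed simp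

lemma pnorm_rmult: "pnorm (tensor_rmult u a) \<le> norm a * pnorm u"
proof (rule pnorm_bounded_map)
  fix xs :: "('a \<times> 'a) list"
  have "tcost (map (\<lambda>(b, c). (b, c * a)) xs) \<le> norm a * tcost xs"
  proof (induction xs)
    case (Cons p xs)
    have "norm (fst p) * norm (snd p * a) \<le> norm a * (norm (fst p) * norm (snd p))"
      using mult_left_mono[OF norm_mult_ineq[of "snd p" a] norm_ge_zero[of "fst p"]]
      by (simp add: ac_simps)
    with Cons show ?case by (auto simp: tcost_def distrib_left case_prod_unfold)
  qed (simp add: tcost_def)
  then show "\<exists>ys. tensor_rmult (tensor_of_list xs) a = tensor_of_list ys \<and> tcost ys \<le> norm a * tcost xs"
    by (intro exI[of _ "map (\<lambda>(b, c). (b, c * a)) xs"])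
      (simp add: tensor_of_list_abs tensor_rmult.abs_eq)
qed simp

lemma norm_tensor_prod: "norm (tensor_prod u) \<le> pnorm u"
proof (rule field_le_epsilon)
  fix e :: real assume "0 < e"
  then obtain xs where xs: "u = tensor_of_list xs" "tcost xs < pnorm u + e"
    using pnorm_approx[of u "pnorm u + e"] by auto
  have "norm (tensor_prod (tensor_of_list xs)) \<le> tcost xs"
    unfolding tensor_of_list_abs tensor_prod.abs_eq
  proof (induction xs)
    case (Cons p xs)
    have "norm (fst p * snd p) \<le> norm (fst p) * norm (snd p)" by (rule norm_mult_ineq)
    with Cons norm_triangle_ineq[of "fst p * snd p" "\<Sum>(b, c)\<leftarrow>xs. b * c"]
    show ?case by (auto simp: tcost_def case_prod_unfold)
  qed (simp add: tcost_def)
  with xs show "norm (tensor_prod u) \<le> pnorm u + e" by simp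
qed


section \<open>The projective tensor product\<close>

text \<open>The completion is realised by Cauchy sequences modulo sequences of projective norm tending
  to 0. This construction does not need that \<^const>\<open>pnorm\<close> is definite.\<close>

definition pCauchy ::
  "(nat \<Rightarrow> ('a::complex_normed_vector, 'b::complex_normed_vector) tensor) \<Rightarrow> bool" where
  "pCauchy X \<longleftrightarrow> (\<forall>e>0. \<exists>M. \<forall>m\<ge>M. \<forall>n\<ge>M. pnorm (X m - X n) < e)"

definition ptensor_rel ::
  "(nat \<Rightarrow> ('a::complex_normed_vector, 'b::complex_normed_vector) tensor)
    \<Rightarrow> (nat \<Rightarrow> ('a, 'b) tensor) \<Rightarrow> bool" where
  "ptensor_rel X Y \<longleftrightarrow> pCauchy X \<and> pCauchy Y \<and> (\<lambda>n. pnorm (X n - Y n)) \<longlonglongrightarrow> 0"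

lemma pCauchy_const: "pCauchy (\<lambda>_. u)"
  by (simp add: pCauchy_def pnorm_zero)

lemma pnorm_tendsto_0_bound:
  assumes "f \<longlonglongrightarrow> (0::real)" "\<And>n. pnorm (X n) \<le> f n"
  shows "(\<lambda>n. pnorm (X n)) \<longlonglongrightarrow> 0"
  by (rule tendsto_sandwich[OF _ _ tendsto_const assms(1)]) (simp_all add: pnorm_nonneg assms(2))

lemma ptensor_rel_refl: "ptensor_rel X X \<longleftrightarrow> pCauchy X"
  by (simp add: ptensor_rel_def pnorm_zero)

lemma ptensor_rel_sym: "ptensor_rel X Y \<Longrightarrow> ptensor_rel Y X"
  by (auto simp: ptensor_rel_def pnorm_minus_commute)

lemma ptensor_rel_trans: 
  assumes "ptensor_rel X Y" "ptensor_rel Y Z" shows "ptensor_rel X Z"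
proof -
  have "(\<lambda>n. pnorm (X n - Y n) + pnorm (Y n - Z n)) \<longlonglongrightarrow> 0"
    using assms tendsto_add[of "\<lambda>n. pnorm (X n - Y n)" 0 _ "\<lambda>n. pnorm (Y n - Z n)" 0]
    by (simp add: ptensor_rel_def)
  then have "(\<lambda>n. pnorm (X n - Z n)) \<longlonglongrightarrow> 0"
    by (rule pnorm_tendsto_0_bound) (rule pnorm_diff_triangle)
  with assms show ?thesis by (simp add: ptensor_rel_def)
qed

quotient_type (overloaded) ('a, 'b) ptensor =
  "nat \<Rightarrow> ('a::complex_normed_vector, 'b::complex_normed_vector) tensor" / partial: ptensor_rel
proof (rule part_equivpI)
  show "\<exists>X. ptensor_rel X X" using pCauchy_const ptensor_rel_refl by blast
qed (auto intro!: sympI transpI intro: ptensor_rel_sym ptensor_rel_trans)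

lemma pCauchy_bounded_map:
  assumes "\<And>u v. pnorm (F u - F v) \<le> K * pnorm (u - v)" "0 \<le> K" "pCauchy X"
  shows "pCauchy (\<lambda>n. F (X n))"
  unfolding pCauchy_def
proof (intro allI impI)
  fix e :: real assume "e > 0"
  then have d: "e / (K + 1) > 0" using assms(2) by simp
  then obtain M where M: "\<And>m n. m \<ge> M \<Longrightarrow> n \<ge> M \<Longrightarrow> pnorm (X m - X n) < e / (K + 1)"
    using assms(3) unfolding pCauchy_def by meson
  have "pnorm (F (X m) - F (X n)) < e" if "m \<ge> M" "n \<ge> M" for m n
  proof -
    have "pnorm (F (X m) - F (X n)) \<le> K * pnorm (X m - X n)" by (rule assms(1))
    also have "\<dots> \<le> (K + 1) * pnorm (X m - X n)"
      by (intro mult_right_mono) (simp_all add: pnorm_nonneg)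
    also have "\<dots> < (K + 1) * (e / (K + 1))"
      using M[OF that] assms(2) by (intro mult_strict_left_mono) auto
    also have "\<dots> = e" using assms(2) by simp
    finally show ?thesis .
  qed
  then show "\<exists>M. \<forall>m\<ge>M. \<forall>n\<ge>M. pnorm (F (X m) - F (X n)) < e" by blast
qed

lemma ptensor_rel_bounded_map:
  assumes "\<And>u v. pnorm (F u - F v) \<le> K * pnorm (u - v)" "0 \<le> K" "ptensor_rel X Y"
  shows "ptensor_rel (\<lambda>n. F (X n)) (\<lambda>n. F (Y n))"
proof -
  have "(\<lambda>n. K * pnorm (X n - Y n)) \<longlonglongrightarrow> 0"
    using assms(3) by (auto simp: ptensor_rel_def intro: tendsto_mult_right_zero)
  then have "(\<lambda>n. pnorm (F (X n) - F (Y n))) \<longlonglongrightarrow> 0"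
    by (rule pnorm_tendsto_0_bound) (rule assms(1))
  with assms show ?thesis by (auto simp: ptensor_rel_def intro: pCauchy_bounded_map)
qed

lemma pnorm_add_diff: "pnorm ((u + v) - (u' + v')) \<le> pnorm (u - u') + pnorm (v - v')"
  using pnorm_triangle[of "u - u'" "v - v'"] by (simp add: algebra_simps)

lemma pCauchy_add:
  assumes "pCauchy X" "pCauchy Y" shows "pCauchy (\<lambda>n. X n + Y n)"
  unfolding pCauchy_def
proof (intro allI impI)
  fix e :: real assume "e > 0"
  then have "e / 2 > 0" by simp
  with assms obtain M N where M: "\<And>m n. m \<ge> M \<Longrightarrow> n \<ge> M \<Longrightarrow> pnorm (X m - X n) < e / 2"
    and N: "\<And>m n. m \<ge> N \<Longrightarrow> n \<ge> N \<Longrightarrow> pnorm (Y m - Y n) < e / 2"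
    unfolding pCauchy_def by metis
  have "pnorm ((X m + Y m) - (X n + Y n)) < e" if "m \<ge> max M N" "n \<ge> max M N" for m n
    using pnorm_add_diff[of "X m" "Y m" "X n" "Y n"] M[of m n] N[of m n] that by simp
  then show "\<exists>M. \<forall>m\<ge>M. \<forall>n\<ge>M. pnorm ((X m + Y m) - (X n + Y n)) < e" by blast
qed

lemma ptensor_rel_add:
  assumes "ptensor_rel X X'" "ptensor_rel Y Y'"
  shows "ptensor_rel (\<lambda>n. X n + Y n) (\<lambda>n. X' n + Y' n)"
proof -
  have "(\<lambda>n. pnorm (X n - X' n) + pnorm (Y n - Y' n)) \<longlonglongrightarrow> 0"
    using assms tendsto_add[of "\<lambda>n. pnorm (X n - X' n)" 0 _ "\<lambda>n. pnorm (Y n - Y' n)" 0]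
    by (simp add: ptensor_rel_def)
  then have "(\<lambda>n. pnorm ((X n + Y n) - (X' n + Y' n))) \<longlonglongrightarrow> 0"
    by (rule pnorm_tendsto_0_bound) (rule pnorm_add_diff)
  with assms show ?thesis by (auto simp: ptensor_rel_def intro: pCauchy_add)
qed

lemma ptensor_rel_eqI: "pCauchy X \<Longrightarrow> (\<And>n. X n = Y n) \<Longrightarrow> ptensor_rel X Y"
  using ptensor_rel_refl[of X] by (metis ext)

lemma pCauchy_scaleC: "pCauchy X \<Longrightarrow> pCauchy (\<lambda>n. c *\<^sub>C X n)"
  by (rule pCauchy_bounded_map[where K = "cmod c"])
    (simp_all add: pnorm_scaleC flip: scaleC_diff_right)

lemma pCauchy_norm_convergent: "pCauchy X \<Longrightarrow> convergent (\<lambda>n. pnorm (X n))"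
  unfolding Cauchy_convergent_iff[symmetric] Cauchy_def pCauchy_def dist_real_def
  by (meson le_less_trans pnorm_abs_diff)

lemma ptensor_rel_lim:
  assumes "ptensor_rel X Y" shows "lim (\<lambda>n. pnorm (X n)) = lim (\<lambda>n. pnorm (Y n))"
proof -
  have X: "(\<lambda>n. pnorm (X n)) \<longlonglongrightarrow> lim (\<lambda>n. pnorm (X n))"
    using assms pCauchy_norm_convergent by (auto simp: ptensor_rel_def convergent_LIMSEQ_iff)
  have "(\<lambda>n. \<bar>pnorm (X n) - pnorm (Y n)\<bar>) \<longlonglongrightarrow> 0"
  proof (rule tendsto_sandwich[OF _ _ tendsto_const])
    show "(\<lambda>n. pnorm (X n - Y n)) \<longlonglongrightarrow> 0" using assms by (simp add: ptensor_rel_def)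
  qed (simp_all add: pnorm_abs_diff)
  then have "(\<lambda>n. pnorm (X n) - pnorm (Y n)) \<longlonglongrightarrow> 0"
    by (rule tendsto_rabs_zero_cancel)
  from tendsto_diff[OF X this] show ?thesis by (simp add: limI)
qed

instantiation ptensor :: (complex_normed_vector, complex_normed_vector) complex_vector
begin

lift_definition zero_ptensor :: "('a, 'b) ptensor" is "\<lambda>_. 0"
  by (simp add: ptensor_rel_refl pCauchy_const)

lift_definition plus_ptensor :: "('a, 'b) ptensor \<Rightarrow> ('a, 'b) ptensor \<Rightarrow> ('a, 'b) ptensor"
  is "\<lambda>X Y n. X n + Y n"
  by (rule ptensor_rel_add)

lift_definition scaleC_ptensor :: "complex \<Rightarrow> ('a, 'b) ptensor \<Rightarrow> ('a, 'b) ptensor"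
  is "\<lambda>c X n. c *\<^sub>C X n"
proof -
  fix c and X Y :: "nat \<Rightarrow> ('a, 'b) tensor" assume "ptensor_rel X Y"
  then show "ptensor_rel (\<lambda>n. c *\<^sub>C X n) (\<lambda>n. c *\<^sub>C Y n)"
    by (rule ptensor_rel_bounded_map[where K = "cmod c", rotated 2])
      (simp_all add: pnorm_scaleC flip: scaleC_diff_right)
qed

definition uminus_ptensor :: "('a, 'b) ptensor \<Rightarrow> ('a, 'b) ptensor" where
  "uminus_ptensor u = (- 1) *\<^sub>C u"

definition minus_ptensor :: "('a, 'b) ptensor \<Rightarrow> ('a, 'b) ptensor \<Rightarrow> ('a, 'b) ptensor" where
  "minus_ptensor u v = u + (- v)"

definition scaleR_ptensor :: "real \<Rightarrow> ('a, 'b) ptensor \<Rightarrow> ('a, 'b) ptensor" where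
  "scaleR_ptensor r u = complex_of_real r *\<^sub>C u"

instance
proof
  fix u v w :: "('a, 'b) ptensor" and c d :: complex and r s :: real
  note [simp] = ptensor_rel_refl
  note [intro] = pCauchy_add pCauchy_scaleC pCauchy_const
  show "u + v + w = u + (v + w)"
    by transfer (auto intro!: ptensor_rel_eqI simp: add.assoc)
  show "u + v = v + u" by transfer (auto intro!: ptensor_rel_eqI simp: add.commute)
  show "0 + u = u" by transfer simp
  show "- u + u = 0"
    unfolding uminus_ptensor_def
    by transfer (auto intro!: ptensor_rel_eqI simp flip: uminus_tensor_def)
  show "u - v = u + - v" by (simp add: minus_ptensor_def)
  have add_right: "e *\<^sub>C (x + y) = e *\<^sub>C x + e *\<^sub>C y" for e and x y :: "('a, 'b) ptensor"
    by transfer (auto intro!: ptensor_rel_eqI simp: scaleC_add_right)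
  have add_left: "(e + f) *\<^sub>C x = e *\<^sub>C x + f *\<^sub>C x" for e f and x :: "('a, 'b) ptensor"
    by transfer (auto intro!: ptensor_rel_eqI simp: scaleC_add_left)
  have scale: "e *\<^sub>C f *\<^sub>C x = (e * f) *\<^sub>C x" for e f and x :: "('a, 'b) ptensor"
    by transfer (auto intro!: ptensor_rel_eqI simp: scaleC_scaleC)
  have one: "1 *\<^sub>C x = x" for x :: "('a, 'b) ptensor"
    by transfer (auto intro!: ptensor_rel_eqI simp: scaleC_one)
  show "c *\<^sub>C (u + v) = c *\<^sub>C u + c *\<^sub>C v" "(c + d) *\<^sub>C u = c *\<^sub>C u + d *\<^sub>C u"
    "c *\<^sub>C d *\<^sub>C u = (c * d) *\<^sub>C u" "r *\<^sub>R u = complex_of_real r *\<^sub>C u"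
    "r *\<^sub>R (u + v) = r *\<^sub>R u + r *\<^sub>R v" "(r + s) *\<^sub>R u = r *\<^sub>R u + s *\<^sub>R u"
    "r *\<^sub>R s *\<^sub>R u = (r * s) *\<^sub>R u" "1 *\<^sub>R u = u"
    by (simp_all add: scaleR_ptensor_def add_right add_left scale one)
qed

end

lemma ptensor_cases:
  obtains X where "pCauchy X" "u = abs_ptensor X"
  using Quotient_ptensor unfolding Quotient_def
  by (metis ptensor_rel_refl)

instantiation ptensor :: (complex_normed_vector, complex_normed_vector) complex_normed_vector
begin

lift_definition norm_ptensor :: "('a, 'b) ptensor \<Rightarrow> real" is "\<lambda>X. lim (\<lambda>n. pnorm (X n))"
  by (rule ptensor_rel_lim)

definition dist_ptensor :: "('a, 'b) ptensor \<Rightarrow> ('a, 'b) ptensor \<Rightarrow> real" where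
  "dist_ptensor u v = norm (u - v)"

definition sgn_ptensor :: "('a, 'b) ptensor \<Rightarrow> ('a, 'b) ptensor" where
  "sgn_ptensor u = u /\<^sub>R norm u"

definition uniformity_ptensor :: "(('a, 'b) ptensor \<times> ('a, 'b) ptensor) filter" where
  "uniformity_ptensor = (INF e\<in>{0 <..}. principal {(x, y). dist x y < e})"

definition open_ptensor :: "('a, 'b) ptensor set \<Rightarrow> bool" where
  "open_ptensor S \<longleftrightarrow> (\<forall>x\<in>S. \<forall>\<^sub>F (x', y) in uniformity. x' = x \<longrightarrow> y \<in> S)"

lemma norm_ptensor_LIMSEQ:
  "pCauchy X \<Longrightarrow> (\<lambda>n. pnorm (X n)) \<longlonglongrightarrow> norm (abs_ptensor X)"
  using pCauchy_norm_convergent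
  by (simp add: norm_ptensor.abs_eq eq_onp_def ptensor_rel_refl convergent_LIMSEQ_iff)

instance
proof
  fix u v :: "('a, 'b) ptensor" and c :: complex and r :: real
  obtain X where X: "pCauchy X" "u = abs_ptensor X" by (rule ptensor_cases)
  obtain Y where Y: "pCauchy Y" "v = abs_ptensor Y" by (rule ptensor_cases)
  note limX = norm_ptensor_LIMSEQ[OF X(1)] and limY = norm_ptensor_LIMSEQ[OF Y(1)]
  show "dist u v = norm (u - v)" by (rule dist_ptensor_def)
  show "sgn u = u /\<^sub>R norm u" by (rule sgn_ptensor_def)
  show "uniformity = (INF e\<in>{0 <..}. principal {(x, y :: ('a, 'b) ptensor). dist x y < e})"
    by (rule uniformity_ptensor_def)
  show "open U \<longleftrightarrow> (\<forall>x\<in>U. \<forall>\<^sub>F (x', y) in uniformity. x' = x \<longrightarrow> y \<in> U)"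
    for U :: "('a, 'b) ptensor set" by (rule open_ptensor_def)
  have "ptensor_rel X (\<lambda>_. 0) \<longleftrightarrow> norm u = 0"
    using limX X by (auto simp: ptensor_rel_def pCauchy_const dest: LIMSEQ_unique)
  moreover have "ptensor_rel X (\<lambda>_. 0) \<longleftrightarrow> u = 0"
    unfolding X(2) zero_ptensor_def
    using Quotient_rel[OF Quotient_ptensor, of X "\<lambda>_. 0"] X(1)
    by (simp add: ptensor_rel_refl pCauchy_const)
  ultimately show "norm u = 0 \<longleftrightarrow> u = 0" by simp
  have "u + v = abs_ptensor (\<lambda>n. X n + Y n)"
    using X Y by (simp add: plus_ptensor.abs_eq eq_onp_def ptensor_rel_refl)
  with norm_ptensor_LIMSEQ[OF pCauchy_add[OF X(1) Y(1)]]
  have "(\<lambda>n. pnorm (X n + Y n)) \<longlonglongrightarrow> norm (u + v)" by simp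
  from LIMSEQ_le[OF this tendsto_add[OF limX limY]] show "norm (u + v) \<le> norm u + norm v"
    using pnorm_triangle X Y by auto
  have scale: "norm (e *\<^sub>C u) = cmod e * norm u" for e
  proof -
    have "e *\<^sub>C u = abs_ptensor (\<lambda>n. e *\<^sub>C X n)"
      using X by (simp add: scaleC_ptensor.abs_eq eq_onp_def ptensor_rel_refl)
    with norm_ptensor_LIMSEQ[OF pCauchy_scaleC[OF X(1)]]
    have "(\<lambda>n. pnorm (e *\<^sub>C X n)) \<longlonglongrightarrow> norm (e *\<^sub>C u)" by simp
    moreover have "(\<lambda>n. pnorm (e *\<^sub>C X n)) \<longlonglongrightarrow> cmod e * norm u"
      unfolding pnorm_scaleC X(2) by (intro tendsto_mult_left limX)
    ultimately show ?thesis by (rule LIMSEQ_unique)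
  qed
  then show "norm (c *\<^sub>C u) = cmod c * norm u" .
  show "norm (r *\<^sub>R u) = \<bar>r\<bar> * norm u" by (simp add: scaleR_scaleC scale)
qed

end

definition ptensor_of ::
  "('a::complex_normed_vector, 'b::complex_normed_vector) tensor \<Rightarrow> ('a, 'b) ptensor" where
  "ptensor_of u = abs_ptensor (\<lambda>_. u)"

lemma norm_ptensor_of: "norm (ptensor_of u) = pnorm u"
  unfolding ptensor_of_def
  by (rule LIMSEQ_unique[OF norm_ptensor_LIMSEQ[OF pCauchy_const] tendsto_const])

lemma abs_ptensor_diff:
  "pCauchy X \<Longrightarrow> pCauchy Y \<Longrightarrow> abs_ptensor X - abs_ptensor Y = abs_ptensor (\<lambda>n. X n - Y n)"
  using pCauchy_scaleC[of Y "- 1"] unfolding minus_ptensor_def uminus_ptensor_def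
  by (simp add: plus_ptensor.abs_eq scaleC_ptensor.abs_eq ptensor_rel_refl flip: uminus_tensor_def)

lemma pCauchy_diff: "pCauchy X \<Longrightarrow> pCauchy Y \<Longrightarrow> pCauchy (\<lambda>n. X n - Y n)"
  using pCauchy_add[of X "\<lambda>n. (- 1) *\<^sub>C Y n"] pCauchy_scaleC[of Y "- 1"]
  by (simp flip: uminus_tensor_def)

lemma ptensor_of_tendsto:
  assumes "pCauchy X" shows "(\<lambda>n. ptensor_of (X n)) \<longlonglongrightarrow> abs_ptensor X"
proof (rule metric_LIMSEQ_I)
  fix e :: real assume "0 < e"
  then obtain M where M: "\<And>m n. m \<ge> M \<Longrightarrow> n \<ge> M \<Longrightarrow> pnorm (X m - X n) < e / 2"
    using assms unfolding pCauchy_def by (meson half_gt_zero)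
  have "dist (ptensor_of (X m)) (abs_ptensor X) < e" if "m \<ge> M" for m
  proof -
    have eq: "ptensor_of (X m) - abs_ptensor X = abs_ptensor (\<lambda>n. X m - X n)"
      unfolding ptensor_of_def by (rule abs_ptensor_diff[OF pCauchy_const assms])
    have "(\<lambda>n. pnorm (X m - X n)) \<longlonglongrightarrow> norm (ptensor_of (X m) - abs_ptensor X)"
      unfolding eq by (rule norm_ptensor_LIMSEQ[OF pCauchy_diff[OF pCauchy_const assms]])
    then have "norm (ptensor_of (X m) - abs_ptensor X) \<le> e / 2"
      by (rule LIMSEQ_le_const2) (use M[OF that] in \<open>auto intro: less_imp_le\<close>)
    with \<open>0 < e\<close> show ?thesis by (simp add: dist_norm)
  qed
  then show "\<exists>M. \<forall>m\<ge>M. dist (ptensor_of (X m)) (abs_ptensor X) < e" by blast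
qed

lemma ptensor_of_dense: "closure (range ptensor_of) = UNIV"
proof -
  have "u \<in> closure (range ptensor_of)" for u :: "('a, 'b) ptensor"
    by (rule ptensor_cases[of u]) (auto simp: closure_sequential intro!: exI ptensor_of_tendsto)
  then show ?thesis by auto
qed

lemma ptensor_of_diff: "ptensor_of (u - v) = ptensor_of u - ptensor_of v"
  by (simp add: ptensor_of_def abs_ptensor_diff pCauchy_const)

instance ptensor :: (complex_normed_vector, complex_normed_vector) banach
proof
  fix U :: "nat \<Rightarrow> ('a, 'b) ptensor" assume "Cauchy U"
  have "\<exists>x. dist (ptensor_of x) (U n) < 1 / real (Suc n)" for n
  proof -
    have "U n \<in> closure (range ptensor_of)" by (simp add: ptensor_of_dense)
    from this[unfolded closure_approachable, rule_format, of "1 / real (Suc n)"]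
    show ?thesis by auto
  qed
  then obtain X where X: "\<And>n. dist (ptensor_of (X n)) (U n) < 1 / real (Suc n)" by metis
  have lim0: "(\<lambda>n. dist (ptensor_of (X n)) (U n)) \<longlonglongrightarrow> 0"
    by (rule tendsto_sandwich[OF _ _ tendsto_const LIMSEQ_inverse_real_of_nat])
      (use X in \<open>auto simp: inverse_eq_divide intro!: always_eventually less_imp_le\<close>)
  have "pCauchy X"
    unfolding pCauchy_def
  proof (intro allI impI)
    fix e :: real assume "e > 0"
    then have e: "e / 3 > 0" by simp
    obtain M where M: "\<And>m n. m \<ge> M \<Longrightarrow> n \<ge> M \<Longrightarrow> dist (U m) (U n) < e / 3"
      using \<open>Cauchy U\<close> e unfolding Cauchy_def by metis
    obtain N where N: "\<And>n. n \<ge> N \<Longrightarrow> dist (ptensor_of (X n)) (U n) < e / 3"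
      using metric_LIMSEQ_D[OF lim0 e] by (auto simp: dist_real_def)
    have "pnorm (X m - X n) < e" if "m \<ge> max M N" "n \<ge> max M N" for m n
    proof -
      have "pnorm (X m - X n) = dist (ptensor_of (X m)) (ptensor_of (X n))"
        by (simp add: dist_norm norm_ptensor_of flip: ptensor_of_diff)
      also have "\<dots> \<le> dist (ptensor_of (X m)) (U m) + dist (U m) (U n) + dist (ptensor_of (X n)) (U n)"
        using dist_triangle[of "ptensor_of (X m)" "ptensor_of (X n)" "U m"]
          dist_triangle[of "U m" "ptensor_of (X n)" "U n"]
        by (simp add: dist_commute)
      also have "\<dots> < e" using M[of m n] N[of m] N[of n] that by simp
      finally show ?thesis .
    qed
    then show "\<exists>M. \<forall>m\<ge>M. \<forall>n\<ge>M. pnorm (X m - X n) < e" by blast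
  qed
  moreover have "(\<lambda>n. ptensor_of (X n) - U n) \<longlonglongrightarrow> 0"
    using lim0 unfolding dist_norm by (rule tendsto_norm_zero_cancel)
  ultimately have "U \<longlonglongrightarrow> abs_ptensor X"
    using Lim_transform2 ptensor_of_tendsto by blast
  then show "convergent U" by (auto simp: convergent_def)
qed

subsection \<open>Bimodule actions and product map\<close>

lift_definition ptensor_lmult ::
  "'b::complex_banach_algebra \<Rightarrow> ('b, 'b) ptensor \<Rightarrow> ('b, 'b) ptensor" (infixr "\<bullet>\<^sub>l" 75)
  is "\<lambda>a X n. tensor_lmult a (X n)"
proof -
  fix a and X Y :: "nat \<Rightarrow> ('b, 'b) tensor" assume "ptensor_rel X Y"
  then show "ptensor_rel (\<lambda>n. tensor_lmult a (X n)) (\<lambda>n. tensor_lmult a (Y n))"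
    by (rule ptensor_rel_bounded_map[where K = "norm a", rotated 2])
      (simp_all add: pnorm_lmult flip: tensor_lmult_diff)
qed

lift_definition ptensor_rmult ::
  "('b, 'b) ptensor \<Rightarrow> 'b::complex_banach_algebra \<Rightarrow> ('b, 'b) ptensor" (infixl "\<bullet>\<^sub>r" 75)
  is "\<lambda>X a n. tensor_rmult (X n) a"
proof -
  fix a and X Y :: "nat \<Rightarrow> ('b, 'b) tensor" assume "ptensor_rel X Y"
  then show "ptensor_rel (\<lambda>n. tensor_rmult (X n) a) (\<lambda>n. tensor_rmult (Y n) a)"
    by (rule ptensor_rel_bounded_map[where K = "norm a", rotated 2])
      (simp_all add: pnorm_rmult flip: tensor_rmult_diff)
qed

lemma tensor_prod_convergent:
  assumes "pCauchy X" shows "convergent (\<lambda>n. tensor_prod (X n))"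
proof -
  have "Cauchy (\<lambda>n. tensor_prod (X n))"
    using assms unfolding Cauchy_def pCauchy_def dist_norm tensor_prod_diff[symmetric]
    by (meson le_less_trans norm_tensor_prod)
  then show ?thesis by (rule Cauchy_convergent)
qed

lift_definition product_map :: "('b::complex_banach_algebra, 'b) ptensor \<Rightarrow> 'b"
  is "\<lambda>X. lim (\<lambda>n. tensor_prod (X n))"
proof -
  fix X Y :: "nat \<Rightarrow> ('b, 'b) tensor" assume r: "ptensor_rel X Y"
  have X: "(\<lambda>n. tensor_prod (X n)) \<longlonglongrightarrow> lim (\<lambda>n. tensor_prod (X n))"
    using r tensor_prod_convergent by (auto simp: ptensor_rel_def convergent_LIMSEQ_iff)
  have "(\<lambda>n. tensor_prod (X n - Y n)) \<longlonglongrightarrow> 0"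
    by (rule Lim_null_comparison[where g = "\<lambda>n. pnorm (X n - Y n)"])
      (use r in \<open>auto simp: ptensor_rel_def norm_tensor_prod\<close>)
  from tendsto_diff[OF X this] show "lim (\<lambda>n. tensor_prod (X n)) = lim (\<lambda>n. tensor_prod (Y n))"
    by (simp add: tensor_prod_diff limI)
qed

lemma ptensor_lmult_of: "a \<bullet>\<^sub>l ptensor_of u = ptensor_of (tensor_lmult a u)"
  by (simp add: ptensor_of_def ptensor_lmult.abs_eq eq_onp_def ptensor_rel_refl pCauchy_const)

lemma ptensor_rmult_of: "ptensor_of u \<bullet>\<^sub>r a = ptensor_of (tensor_rmult u a)"
  by (simp add: ptensor_of_def ptensor_rmult.abs_eq eq_onp_def ptensor_rel_refl pCauchy_const)

lemma product_map_of: "product_map (ptensor_of u) = tensor_prod u"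
  by (simp add: ptensor_of_def product_map.abs_eq eq_onp_def ptensor_rel_refl pCauchy_const limI)

lemma pCauchy_tensor_lmult: "pCauchy X \<Longrightarrow> pCauchy (\<lambda>n. tensor_lmult a (X n))"
  by (rule pCauchy_bounded_map[where K = "norm a"])
    (simp_all add: pnorm_lmult flip: tensor_lmult_diff)

lemma pCauchy_tensor_rmult: "pCauchy X \<Longrightarrow> pCauchy (\<lambda>n. tensor_rmult (X n) a)"
  by (rule pCauchy_bounded_map[where K = "norm a"])
    (simp_all add: pnorm_rmult flip: tensor_rmult_diff)

lemma product_map_LIMSEQ:
  "pCauchy X \<Longrightarrow> (\<lambda>n. tensor_prod (X n)) \<longlonglongrightarrow> product_map (abs_ptensor X)"
  using tensor_prod_convergent
  by (simp add: product_map.abs_eq eq_onp_def ptensor_rel_refl convergent_LIMSEQ_iff)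

lemma clinear_ptensor_lmult:
  "a \<bullet>\<^sub>l (u + v) = a \<bullet>\<^sub>l u + a \<bullet>\<^sub>l v" "a \<bullet>\<^sub>l (c *\<^sub>C u) = c *\<^sub>C (a \<bullet>\<^sub>l u)"
  by (transfer, auto intro!: ptensor_rel_eqI pCauchy_tensor_lmult pCauchy_add pCauchy_scaleC
      simp: ptensor_rel_refl tensor_lmult_add tensor_lmult_scaleC)+

lemma clinear_ptensor_rmult:
  "(u + v) \<bullet>\<^sub>r a = u \<bullet>\<^sub>r a + v \<bullet>\<^sub>r a" "(c *\<^sub>C u) \<bullet>\<^sub>r a = c *\<^sub>C (u \<bullet>\<^sub>r a)"
  by (transfer, auto intro!: ptensor_rel_eqI pCauchy_tensor_rmult pCauchy_add pCauchy_scaleC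
      simp: ptensor_rel_refl tensor_rmult_add tensor_rmult_scaleC)+

lemma norm_ptensor_lmult: "norm (a \<bullet>\<^sub>l u) \<le> norm a * norm u"
proof -
  obtain X where X: "pCauchy X" "u = abs_ptensor X" by (rule ptensor_cases)
  then have eq: "a \<bullet>\<^sub>l u = abs_ptensor (\<lambda>n. tensor_lmult a (X n))"
    by (simp add: ptensor_lmult.abs_eq eq_onp_def ptensor_rel_refl)
  show ?thesis
    unfolding eq unfolding X(2)
    by (rule LIMSEQ_le[OF norm_ptensor_LIMSEQ[OF pCauchy_tensor_lmult[OF X(1)]]
          tendsto_mult_left[OF norm_ptensor_LIMSEQ[OF X(1)]]])
      (auto simp: pnorm_lmult intro: exI)
qed

lemma norm_ptensor_rmult: "norm (u \<bullet>\<^sub>r a) \<le> norm a * norm u"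
proof -
  obtain X where X: "pCauchy X" "u = abs_ptensor X" by (rule ptensor_cases)
  then have eq: "u \<bullet>\<^sub>r a = abs_ptensor (\<lambda>n. tensor_rmult (X n) a)"
    by (simp add: ptensor_rmult.abs_eq eq_onp_def ptensor_rel_refl)
  show ?thesis
    unfolding eq unfolding X(2)
    by (rule LIMSEQ_le[OF norm_ptensor_LIMSEQ[OF pCauchy_tensor_rmult[OF X(1)]]
          tendsto_mult_left[OF norm_ptensor_LIMSEQ[OF X(1)]]])
      (auto simp: pnorm_rmult intro: exI)
qed

lemma clinear_product_map:
  fixes u v :: "('b::complex_banach_algebra, 'b) ptensor"
  shows "product_map (u + v) = product_map u + product_map v"
    and "product_map (c *\<^sub>C u) = c *\<^sub>C product_map u"
proof -
  obtain X where X: "pCauchy X" "u = abs_ptensor X" by (rule ptensor_cases)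
  obtain Y where Y: "pCauchy Y" "v = abs_ptensor Y" by (rule ptensor_cases)
  have "u + v = abs_ptensor (\<lambda>n. X n + Y n)"
    using X Y by (simp add: plus_ptensor.abs_eq eq_onp_def ptensor_rel_refl)
  with product_map_LIMSEQ[OF pCauchy_add[OF X(1) Y(1)]]
  have "(\<lambda>n. tensor_prod (X n) + tensor_prod (Y n)) \<longlonglongrightarrow> product_map (u + v)"
    by (simp add: tensor_prod_add)
  moreover have "(\<lambda>n. tensor_prod (X n) + tensor_prod (Y n)) \<longlonglongrightarrow> product_map u + product_map v"
    unfolding X(2) Y(2) by (intro tendsto_add product_map_LIMSEQ X(1) Y(1))
  ultimately show "product_map (u + v) = product_map u + product_map v" by (rule LIMSEQ_unique)
  have "c *\<^sub>C u = abs_ptensor (\<lambda>n. c *\<^sub>C X n)"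
    using X by (simp add: scaleC_ptensor.abs_eq eq_onp_def ptensor_rel_refl)
  with product_map_LIMSEQ[OF pCauchy_scaleC[OF X(1), of c]]
  have "(\<lambda>n. c *\<^sub>C tensor_prod (X n)) \<longlonglongrightarrow> product_map (c *\<^sub>C u)"
    by (simp add: tensor_prod_scaleC)
  moreover have "(\<lambda>n. c *\<^sub>C tensor_prod (X n)) \<longlonglongrightarrow> c *\<^sub>C product_map u"
    unfolding X(2)
    by (intro bounded_linear.tendsto[OF bounded_linear_scaleC] product_map_LIMSEQ X(1))
  ultimately show "product_map (c *\<^sub>C u) = c *\<^sub>C product_map u" by (rule LIMSEQ_unique)
qed

lemma norm_product_map: "norm (product_map u) \<le> norm u"
proof -
  obtain X where X: "pCauchy X" "u = abs_ptensor X" by (rule ptensor_cases)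
  show ?thesis
    unfolding X(2)
    by (rule LIMSEQ_le[OF tendsto_norm[OF product_map_LIMSEQ[OF X(1)]] norm_ptensor_LIMSEQ[OF X(1)]])
      (auto simp: norm_tensor_prod)
qed


section \<open>Compactly approximate diagonals\<close>

text \<open>A net is a family indexed by a nonempty directed preordered set \<open>(I, le)\<close>, carried by an
  arbitrary type. No boundedness is required.\<close>

definition directed_set :: "'i set \<Rightarrow> ('i \<Rightarrow> 'i \<Rightarrow> bool) \<Rightarrow> bool" where
  "directed_set I le \<longleftrightarrow> I \<noteq> {} \<and> (\<forall>i\<in>I. le i i)
    \<and> (\<forall>i\<in>I. \<forall>j\<in>I. \<forall>k\<in>I. le i j \<longrightarrow> le j k \<longrightarrow> le i k)
    \<and> (\<forall>i\<in>I. \<forall>j\<in>I. \<exists>k\<in>I. le i k \<and> le j k)"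

definition compactly_approximate_diagonal ::
  "'i set \<Rightarrow> ('i \<Rightarrow> 'i \<Rightarrow> bool) \<Rightarrow> ('i \<Rightarrow> ('b::complex_banach_algebra, 'b) ptensor) \<Rightarrow> bool" where
  "compactly_approximate_diagonal I le u \<longleftrightarrow> directed_set I le \<and>
    (\<forall>K e. compact K \<longrightarrow> e > 0 \<longrightarrow>
      (\<exists>i0\<in>I. \<forall>i\<in>I. le i0 i \<longrightarrow>
        (\<forall>a\<in>K. norm (a \<bullet>\<^sub>l u i - u i \<bullet>\<^sub>r a) < e \<and> norm (product_map (u i) * a - a) < e)))"

definition central_net ::
  "'i set \<Rightarrow> ('i \<Rightarrow> ('b::complex_banach_algebra, 'b) ptensor) \<Rightarrow> bool" where
  "central_net I u \<longleftrightarrow> (\<forall>i\<in>I. \<forall>a. a \<bullet>\<^sub>l u i = u i \<bullet>\<^sub>r a)"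

definition central_compactly_approximate_diagonal ::
  "'i set \<Rightarrow> ('i \<Rightarrow> 'i \<Rightarrow> bool) \<Rightarrow> ('i \<Rightarrow> ('b::complex_banach_algebra, 'b) ptensor) \<Rightarrow> bool" where
  "central_compactly_approximate_diagonal I le u \<longleftrightarrow>
    compactly_approximate_diagonal I le u \<and> central_net I u"

text \<open>Existence of a compactly approximate diagonal does not depend on the type carrying the index
  set: pairs of a compact set and a tolerance always suffice. An existence statement may therefore
  fix this index type.\<close>

lemma compactly_approximate_diagonal_reindex:
  fixes u :: "'i \<Rightarrow> ('b::complex_banach_algebra, 'b) ptensor"
  assumes "compactly_approximate_diagonal I le u"
  shows "\<exists>(J :: ('b set \<times> real) set) le' (v :: 'b set \<times> real \<Rightarrow> ('b, 'b) ptensor).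
    compactly_approximate_diagonal J le' v"
proof -
  let ?P = "\<lambda>K e i. \<forall>a\<in>K. norm (a \<bullet>\<^sub>l u i - u i \<bullet>\<^sub>r a) < e \<and> norm (product_map (u i) * a - a) < e"
  have "\<exists>i. ?P K e i" if "compact K" "e > 0" for K e
  proof -
    obtain i0 where "i0 \<in> I" "\<forall>i\<in>I. le i0 i \<longrightarrow> ?P K e i"
      using assms \<open>compact K\<close> \<open>e > 0\<close> unfolding compactly_approximate_diagonal_def by meson
    moreover have "le i0 i0"
      using assms \<open>i0 \<in> I\<close> by (auto simp: compactly_approximate_diagonal_def directed_set_def)
    ultimately show ?thesis by blast
  qed
  then obtain h where h: "\<And>K e. compact K \<Longrightarrow> e > 0 \<Longrightarrow> ?P K e (h K e)" by metis
  define J :: "('b set \<times> real) set" where "J = {(K, e). compact K \<and> e > 0}"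
  define le' :: "'b set \<times> real \<Rightarrow> 'b set \<times> real \<Rightarrow> bool"
    where "le' = (\<lambda>(K, e) (K', e'). K \<subseteq> K' \<and> e' \<le> e)"
  define v where "v = (\<lambda>(K, e). u (h K e))"
  have "\<exists>k\<in>J. le' (K, d) k \<and> le' (L, e) k" if "(K, d) \<in> J" "(L, e) \<in> J" for K L d e
    using that by (intro bexI[of _ "(K \<union> L, min d e)"]) (auto simp: J_def le'_def)
  moreover have "({}, 1) \<in> J" by (simp add: J_def)
  ultimately have "directed_set J le'"
    unfolding directed_set_def by (auto simp: le'_def)
  moreover have "\<exists>i0\<in>J. \<forall>i\<in>J. le' i0 i \<longrightarrow>
      (\<forall>a\<in>K. norm (a \<bullet>\<^sub>l v i - v i \<bullet>\<^sub>r a) < e \<and> norm (product_map (v i) * a - a) < e)"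
    if "compact K" "e > 0" for K e
  proof (intro bexI[of _ "(K, e)"] ballI impI)
    fix i a assume i: "i \<in> J" "le' (K, e) i" and "a \<in> K"
    obtain L d where [simp]: "i = (L, d)" by force
    have "compact L" "d > 0" "K \<subseteq> L" "d \<le> e" using i by (auto simp: J_def le'_def)
    with h[of L d] \<open>a \<in> K\<close>
    show "norm (a \<bullet>\<^sub>l v i - v i \<bullet>\<^sub>r a) < e \<and> norm (product_map (v i) * a - a) < e"
      by (fastforce simp: v_def)
  qed (use that in \<open>simp add: J_def\<close>)
  ultimately show ?thesis
    unfolding compactly_approximate_diagonal_def by (intro exI[of _ J] exI[of _ le'] exI[of _ v]) blast
qed

end

theory Submission
  imports Defs
begin

text \<open>Let \<open>w\<close> be a central element of the projective tensor square of \<open>A\<close> whose product acts almost as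
  a unit on a given compact subset of \<open>A\<close>. Regarding elements of \<open>A\<close> as constant functions carries
  \<open>w\<close> to an element \<open>w'\<close> of the tensor square of \<open>C(X,A)\<close>. For a compact set \<open>K\<close> of functions the
  values \<open>f x\<close> with \<open>f \<in> K\<close> form a compact set (\<open>compact_values\<close>), so the product of \<open>w'\<close> acts almost
  as a unit on \<open>K\<close>. Moreover \<open>w'\<close> commutes with constant functions, but not with scalar functions.

  The latter is repaired by averaging, as in the proof that a commutative C*-algebra is amenable. A scalar
  function \<open>g\<close> with values on the unit circle acts on the tensor square by the rotation
  \<open>p \<otimes> q \<mapsto> g p \<otimes> g\<^sup>-\<^sup>1 q\<close>. Rotations are contractions, they commute with each other and with the actions
  of constants, and they preserve the product. By an approximate Markov-Kakutani theorem
  (\<open>approximate_common_fixed_point\<close>) the convex set of all \<open>v\<close> that share with \<open>w'\<close> a norm bound,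
  the product and centrality for constants contains elements almost fixed by any finite number of
  rotations. Such elements almost commute with \<open>g a\<close> for the functions \<open>g\<close> in question and constant \<open>a\<close>
  (\<open>norm_commutator_le\<close>). Each scalar function with values in the unit interval is the average of two
  functions with values on the circle, and sums of such functions times constants are dense in \<open>C(X,A)\<close>
  (\<open>unit_interval_combinations_dense\<close>). By the norm bound, almost commutation extends to all functions
  and is uniform on compact sets (\<open>eventually_commutator_less_compact\<close>).

  The order of choices matters: \<open>w\<close>, and with it the norm bound, is fixed before the finite set of
  rotations. So the original diagonal may be unbounded. But the approximating sums, and with them the
  constants \<open>a\<close>, also come after \<open>w\<close>; centrality makes \<open>w\<close> commute with all of them in advance.\<close>

section \<open>Approximate fixed points of commuting maps\<close>

text \<open>An approximate form of the Markov-Kakutani theorem. The mean of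
  \<open>w, T w, \<dots>, T\<^sup>N\<^sup>-\<^sup>1 w\<close> is moved by \<open>T\<close> by at most the diameter of \<open>C\<close> divided by \<open>N\<close>, because the
  sum telescopes. Taking this mean maps \<open>C\<close> onto a convex set that is still invariant under every map
  commuting with \<open>T\<close>, so the maps can be treated one after the other.\<close>
lemma approximate_common_fixed_point:
  fixes C :: "'a::real_normed_vector set"
  assumes "finite \<T>" "C \<noteq> {}" "convex C" "bounded C"
    and lin: "\<And>T. T \<in> \<T> \<Longrightarrow> linear T"
    and comm: "\<And>S T x. S \<in> \<T> \<Longrightarrow> T \<in> \<T> \<Longrightarrow> S (T x) = T (S x)"
    and inv: "\<And>T x. T \<in> \<T> \<Longrightarrow> x \<in> C \<Longrightarrow> T x \<in> C"
    and "e > 0"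
  shows "\<exists>v\<in>C. \<forall>T\<in>\<T>. norm (T v - v) < e"
  using assms(1-7)
proof (induction \<T> arbitrary: C rule: finite_induct)
  case empty
  then show ?case by auto
next
  case (insert T \<T>)
  obtain R where R: "R > 0" "\<And>x. x \<in> C \<Longrightarrow> norm x \<le> R"
    using \<open>bounded C\<close> by (auto simp: bounded_pos)
  \<comment> \<open>The set \<open>C\<close> has diameter at most \<open>2 R\<close>, so this is how many iterates to average.\<close>
  obtain N :: nat where N: "N > 0" "2 * R / real N < e"
    using reals_Archimedean2[of "2 * R / e"] \<open>e > 0\<close> \<open>R > 0\<close>
    by (metis divide_less_eq mult.commute of_nat_0_less_iff divide_pos_pos mult_pos_pos less_trans zero_less_numeral)
  have T: "linear T" using insert.prems by simp
  have pow_lin: "linear (T ^^ k)" for k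
    by (induction k) (use linear_compose[OF _ T] in \<open>auto simp: linear_id linear_id[unfolded id_def] comp_def\<close>)
  have pow_C: "(T ^^ k) x \<in> C" if "x \<in> C" for k x
    using that insert.prems by (induction k) auto
  define M where "M = (\<lambda>x. (1 / real N) *\<^sub>R (\<Sum>k<N. (T ^^ k) x))"
  have M_lin: "linear M"
    unfolding M_def by (intro linear_compose_scale_right linear_compose_sum ballI pow_lin)
  have M_C: "M x \<in> C" if "x \<in> C" for x
  proof -
    have "(\<Sum>k<N. (1 / real N) *\<^sub>R (T ^^ k) x) \<in> C"
      by (rule convex_sum) (use N insert.prems pow_C that in auto)
    then show ?thesis by (simp add: M_def scaleR_sum_right)
  qed
  have pow_comm: "S ((T ^^ k) x) = (T ^^ k) (S x)" if "S \<in> \<T>" for S k x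
    by (induction k) (use that insert.prems(5)[of S T] in auto)
  have M_comm: "S (M x) = M (S x)" if "S \<in> \<T>" for S x
    using insert.prems(4)[of S] that
    by (simp add: M_def linear_scale linear_sum pow_comm)
  have "\<exists>v\<in>M ` C. \<forall>S\<in>\<T>. norm (S v - v) < e"
  proof (rule insert.IH)
    show "M ` C \<noteq> {}" using insert.prems by simp
    show "convex (M ` C)" by (rule convex_linear_image[OF M_lin insert.prems(2)])
    show "bounded (M ` C)" using M_C insert.prems(3) by (meson bounded_subset image_subsetI)
    show "S x \<in> M ` C" if "S \<in> \<T>" "x \<in> M ` C" for S x
      using that M_comm[OF that(1)] insert.prems(6)[of S] by auto
  qed (use insert.prems in auto)
  then obtain w where w: "w \<in> C" "\<forall>S\<in>\<T>. norm (S (M w) - M w) < e" by auto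
  have "T (M w) - M w = (1 / real N) *\<^sub>R (\<Sum>k<N. (T ^^ Suc k) w - (T ^^ k) w)"
    using T by (simp add: M_def linear_scale linear_sum sum_subtractf scaleR_diff_right)
  also have "\<dots> = (1 / real N) *\<^sub>R ((T ^^ N) w - w)"
    by (subst sum_lessThan_telescope[of "\<lambda>k. (T ^^ k) w"]) simp
  finally have "norm (T (M w) - M w) \<le> 1 / real N * (norm ((T ^^ N) w) + norm w)"
    using norm_triangle_ineq4[of "(T ^^ N) w" w] N(1) by (simp add: divide_right_mono)
  also have "\<dots> \<le> 1 / real N * (2 * R)"
    using R(2)[OF pow_C[OF w(1), of N]] R(2)[OF w(1)]
    by (intro mult_left_mono) auto
  finally have "norm (T (M w) - M w) < e" using N(2) by simp
  with w M_C show ?case by blast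
qed

section \<open>Functoriality of the projective tensor product\<close>

text \<open>Contractions are all that occurs below (the embedding of constants and multiplications by
  functions of modulus one), and they make the induced maps on tensor products contractions as well.\<close>
definition clinear_contraction ::
  "('a::complex_normed_vector \<Rightarrow> 'b::complex_normed_vector) \<Rightarrow> bool" where
  "clinear_contraction S \<longleftrightarrow> (\<forall>x y. S (x + y) = S x + S y) \<and>
    (\<forall>c x. S (c *\<^sub>C x) = c *\<^sub>C S x) \<and> (\<forall>x. norm (S x) \<le> norm x)"

lemma clinear_contractionI:
  assumes "\<And>x y. S (x + y) = S x + S y" "\<And>c x. S (c *\<^sub>C x) = c *\<^sub>C S x" "\<And>x. norm (S x) \<le> norm x"
  shows "clinear_contraction S"
  using assms by (simp add: clinear_contraction_def)

lemma clinear_contraction_id: "clinear_contraction (\<lambda>x. x)"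
  by (simp add: clinear_contraction_def)

text \<open>\<open>S \<otimes> T\<close>, first on finite sums of pure tensors and then on the completion. The value does not
  depend on the chosen representative as soon as \<open>S\<close> and \<open>T\<close> are complex linear contractions.\<close>
definition tensor_map ::
  "('a \<Rightarrow> 'c) \<Rightarrow> ('b \<Rightarrow> 'd) \<Rightarrow> ('a::complex_normed_vector, 'b::complex_normed_vector) tensor
    \<Rightarrow> ('c::complex_normed_vector, 'd::complex_normed_vector) tensor" where
  "tensor_map S T u = tensor_of_list (map (map_prod S T) (rep_tensor u))"

definition ptensor_map ::
  "('a \<Rightarrow> 'c) \<Rightarrow> ('b \<Rightarrow> 'd) \<Rightarrow> ('a::complex_normed_vector, 'b::complex_normed_vector) ptensor
    \<Rightarrow> ('c::complex_normed_vector, 'd::complex_normed_vector) ptensor" where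
  "ptensor_map S T u = abs_ptensor (\<lambda>n. tensor_map S T (rep_ptensor u n))"

lemma tensor_map_of_list:
  assumes "clinear_contraction S" "clinear_contraction T"
  shows "tensor_map S T (tensor_of_list xs) = tensor_of_list (map (map_prod S T) xs)"
proof -
  have S0: "S 0 = 0" using assms(1) by (metis add_cancel_right_right clinear_contraction_def)
  have "tensor_rel (rep_tensor (abs_tensor xs)) xs"
    by (simp add: Quotient3_rep_abs[OF Quotient3_tensor] tensor_rel.refl)
  then have "tensor_rel (map (map_prod S T) (rep_tensor (abs_tensor xs))) (map (map_prod S T) xs)"
    by (rule tensor_rel_map)
      (use assms in \<open>auto simp: clinear_contraction_def S0 intro: tensor_rel.intros\<close>)
  then show ?thesis
    by (simp add: tensor_map_def tensor_of_list_abs tensor.abs_eq_iff)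
qed

context
  fixes S :: "'a::complex_normed_vector \<Rightarrow> 'c::complex_normed_vector"
    and T :: "'b::complex_normed_vector \<Rightarrow> 'd::complex_normed_vector"
  assumes S: "clinear_contraction S" and T: "clinear_contraction T"
begin

lemma tensor_map_add: "tensor_map S T (u + v) = tensor_map S T u + tensor_map S T v"
proof -
  obtain xs ys where "u = tensor_of_list xs" "v = tensor_of_list ys"
    using tensor_exhaust by metis
  then show ?thesis
    using tensor_map_of_list[OF S T, of "xs @ ys"]
    by (simp add: tensor_of_list_append tensor_map_of_list[OF S T])
qed

lemma tensor_map_diff: "tensor_map S T (u - v) = tensor_map S T u - tensor_map S T v"
  using tensor_map_add[of "u - v" v] by simp

lemma tensor_map_scaleC: "tensor_map S T (c *\<^sub>C u) = c *\<^sub>C tensor_map S T u"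
proof -
  obtain xs where u: "u = tensor_of_list xs" using tensor_exhaust by metis
  have scale: "c *\<^sub>C tensor_of_list ys = tensor_of_list (map (\<lambda>(a, b). (c *\<^sub>C a, b)) ys)"
    for ys :: "('e::complex_normed_vector \<times> 'f::complex_normed_vector) list"
    by (simp add: tensor_of_list_abs scaleC_tensor.abs_eq)
  show ?thesis
    using S unfolding u scale tensor_map_of_list[OF S T]
    by (simp add: clinear_contraction_def case_prod_unfold comp_def map_prod_def)
qed

lemma pnorm_tensor_map: "pnorm (tensor_map S T u) \<le> pnorm u"
proof -
  have "tcost (map (map_prod S T) xs) \<le> tcost xs" for xs
    using S T
    by (induction xs) (auto simp: tcost_def clinear_contraction_def intro!: add_mono mult_mono)
  then have "\<exists>ys. tensor_map S T (tensor_of_list xs) = tensor_of_list ys \<and> tcost ys \<le> 1 * tcost xs"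
    for xs using tensor_map_of_list[OF S T] by auto
  from pnorm_bounded_map[OF _ this] show ?thesis by simp
qed

lemma ptensor_map_abs:
  assumes "pCauchy X"
  shows "ptensor_map S T (abs_ptensor X) = abs_ptensor (\<lambda>n. tensor_map S T (X n))"
    and "pCauchy (\<lambda>n. tensor_map S T (X n))"
proof -
  have K: "pnorm (tensor_map S T u - tensor_map S T v) \<le> 1 * pnorm (u - v)" for u v
    using pnorm_tensor_map[of "u - v"] by (simp add: tensor_map_diff)
  have "ptensor_rel (rep_ptensor (abs_ptensor X)) X"
    by (rule Quotient3_rep_abs[OF Quotient3_ptensor]) (simp add: ptensor_rel_refl assms)
  from ptensor_rel_bounded_map[OF K _ this]
  show "ptensor_map S T (abs_ptensor X) = abs_ptensor (\<lambda>n. tensor_map S T (X n))"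
    unfolding ptensor_map_def by (simp add: Quotient3_rel_abs[OF Quotient3_ptensor])
  show "pCauchy (\<lambda>n. tensor_map S T (X n))"
    by (rule pCauchy_bounded_map[OF K _ assms]) simp
qed

lemma ptensor_map_of: "ptensor_map S T (ptensor_of u) = ptensor_of (tensor_map S T u)"
  unfolding ptensor_of_def by (rule ptensor_map_abs(1)[OF pCauchy_const])

lemma ptensor_map_pure:
  "ptensor_map S T (ptensor_of (a \<otimes>\<^sub>t b)) = ptensor_of (S a \<otimes>\<^sub>t T b)"
  using tensor_map_of_list[OF S T, of "[(a, b)]"]
  by (simp add: ptensor_map_of tensor_of_list_def)

lemma norm_ptensor_map: "norm (ptensor_map S T u) \<le> norm u"
proof -
  obtain X where X: "pCauchy X" "u = abs_ptensor X" by (rule ptensor_cases)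
  show ?thesis
    unfolding X(2) ptensor_map_abs(1)[OF X(1)]
    by (rule LIMSEQ_le[OF norm_ptensor_LIMSEQ[OF ptensor_map_abs(2)[OF X(1)]]
          norm_ptensor_LIMSEQ[OF X(1)]]) (auto simp: pnorm_tensor_map)
qed

lemma ptensor_map_add: "ptensor_map S T (u + v) = ptensor_map S T u + ptensor_map S T v"
proof -
  obtain X where X: "pCauchy X" "u = abs_ptensor X" by (rule ptensor_cases)
  obtain Y where Y: "pCauchy Y" "v = abs_ptensor Y" by (rule ptensor_cases)
  show ?thesis
    using X Y
    by (simp add: plus_ptensor.abs_eq eq_onp_def ptensor_rel_refl ptensor_map_abs pCauchy_add
        tensor_map_add)
qed

lemma ptensor_map_scaleC: "ptensor_map S T (c *\<^sub>C u) = c *\<^sub>C ptensor_map S T u"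
proof -
  obtain X where X: "pCauchy X" "u = abs_ptensor X" by (rule ptensor_cases)
  then show ?thesis
    by (simp add: scaleC_ptensor.abs_eq eq_onp_def ptensor_rel_refl ptensor_map_abs pCauchy_scaleC
        tensor_map_scaleC)
qed

lemma bounded_linear_ptensor_map: "bounded_linear (ptensor_map S T)"
  by (rule bounded_linear_intro[where K = 1])
    (simp_all add: ptensor_map_add ptensor_map_scaleC scaleR_scaleC norm_ptensor_map)

end

lemma bounded_linear_ptensor_lmult: "bounded_linear (\<lambda>u. a \<bullet>\<^sub>l u)"
  by (rule bounded_linear_intro[where K = "norm a"])
    (simp_all add: clinear_ptensor_lmult scaleR_scaleC norm_ptensor_lmult mult.commute)

lemma bounded_linear_ptensor_rmult: "bounded_linear (\<lambda>u. u \<bullet>\<^sub>r a)"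
  by (rule bounded_linear_intro[where K = "norm a"])
    (simp_all add: clinear_ptensor_rmult scaleR_scaleC norm_ptensor_rmult mult.commute)

lemma bounded_linear_product_map: "bounded_linear product_map"
  by (rule bounded_linear_intro[where K = 1])
    (simp_all add: clinear_product_map scaleR_scaleC norm_product_map)

lemma ptensor_of_add: "ptensor_of (u + v) = ptensor_of u + ptensor_of v"
  using ptensor_of_diff[of "u + v" v] by simp

text \<open>Pure tensors span a dense subspace, so identities between bounded linear maps on the
  projective tensor product need only be checked on them. All module identities below are obtained
  in this way.\<close>
lemma ptensor_bounded_linear_eqI:
  fixes F G :: "('a::complex_normed_vector, 'b::complex_normed_vector) ptensor
    \<Rightarrow> 'c::real_normed_vector"
  assumes "bounded_linear F" "bounded_linear G"
    and pure: "\<And>a b. F (ptensor_of (a \<otimes>\<^sub>t b)) = G (ptensor_of (a \<otimes>\<^sub>t b))"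
  shows "F u = G u"
proof -
  interpret F: bounded_linear F by fact
  interpret G: bounded_linear G by fact
  have of0: "ptensor_of 0 = (0 :: ('a, 'b) ptensor)"
    using ptensor_of_diff[of 0 0] by simp
  have "F (ptensor_of (tensor_of_list xs)) = G (ptensor_of (tensor_of_list xs))" for xs
    by (induction xs)
      (auto simp: tensor_of_list_def of0 ptensor_of_add F.zero G.zero F.add G.add pure)
  then have "range ptensor_of \<subseteq> {u. F u = G u}"
    using tensor_exhaust by (metis (mono_tags, lifting) image_subsetI mem_Collect_eq)
  moreover have "closed {u. F u = G u}"
    by (intro closed_Collect_eq F.continuous_on G.continuous_on continuous_on_id)
  ultimately have "closure (range ptensor_of) \<subseteq> {u. F u = G u}" by (rule closure_minimal)
  then show ?thesis by (auto simp: ptensor_of_dense)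
qed

section \<open>Rotations by unimodular functions\<close>

lift_definition fscale ::
  "('x::topological_space \<Rightarrow>\<^sub>C complex) \<Rightarrow> ('x \<Rightarrow>\<^sub>C 'a::complex_banach_algebra) \<Rightarrow> 'x \<Rightarrow>\<^sub>C 'a"
  is "\<lambda>g f x. g x *\<^sub>C f x"
proof -
  fix g :: "'x \<Rightarrow> complex" and f :: "'x \<Rightarrow> 'a" assume g: "g \<in> bcontfun" and f: "f \<in> bcontfun"
  have "bounded_bilinear (\<lambda>(c::complex) (y::'a). c *\<^sub>C y)"
  proof
    show "\<exists>K. \<forall>(c::complex) (y::'a). norm (c *\<^sub>C y) \<le> norm c * norm y * K"
      by (rule exI[of _ 1]) (simp add: norm_scaleC)
  qed (simp_all add: scaleC_add_left scaleC_add_right scaleR_scaleC scaleC_scaleC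
      scaleR_conv_of_real mult.commute)
  from bounded_bilinear.continuous_on[OF this, of UNIV g f]
  have cont: "continuous_on UNIV (\<lambda>x. g x *\<^sub>C f x)"
    using f g by (simp add: bcontfun_def)
  have "bounded (range g)" "bounded (range f)" using f g by (simp_all add: bcontfun_def)
  then obtain M N where M: "\<forall>y\<in>range g. norm y \<le> M" and N: "\<forall>y\<in>range f. norm y \<le> N"
    unfolding bounded_iff by blast
  have "norm (g x *\<^sub>C f x) \<le> M * N" for x
  proof -
    have "cmod (g x) \<le> M" "norm (f x) \<le> N" using M N by simp_all
    then show ?thesis
      using order_trans[OF norm_ge_zero[of "g x"]] unfolding norm_scaleC by (intro mult_mono) simp_all
  qed
  with cont show "(\<lambda>x. g x *\<^sub>C f x) \<in> bcontfun" by (rule bcontfun_normI)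
qed

lift_definition bcontfun_cnj :: "('x::topological_space \<Rightarrow>\<^sub>C complex) \<Rightarrow> 'x \<Rightarrow>\<^sub>C complex"
  is "\<lambda>g x. cnj (g x)"
  by (auto simp: bcontfun_def bounded_iff intro: continuous_on_cnj)

definition unimodular :: "('x::topological_space \<Rightarrow>\<^sub>C complex) \<Rightarrow> bool" where
  "unimodular g \<longleftrightarrow> (\<forall>x. cmod (apply_bcontfun g x) = 1)"

lemma unimodular_cnj: "unimodular g \<Longrightarrow> unimodular (bcontfun_cnj g)"
  by (simp add: unimodular_def bcontfun_cnj.rep_eq)

lemma clinear_contraction_fscale:
  assumes "unimodular g" shows "clinear_contraction (fscale g)"
proof (rule clinear_contractionI)
  fix p q :: "'a \<Rightarrow>\<^sub>C 'b" and c
  show "fscale g (p + q) = fscale g p + fscale g q" "fscale g (c *\<^sub>C p) = c *\<^sub>C fscale g p"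
    by (auto intro!: bcontfun_eqI
        simp: fscale.rep_eq scaleC_bcontfun.rep_eq scaleC_add_right scaleC_scaleC mult.commute)
  show "norm (fscale g p) \<le> norm p"
    using assms
    by (intro norm_bound) (simp add: fscale.rep_eq norm_scaleC unimodular_def norm_bounded)
qed

lemma clinear_contraction_const:
  "clinear_contraction (const_bcontfun :: 'a \<Rightarrow> 'x::topological_space \<Rightarrow>\<^sub>C 'a::complex_banach_algebra)"
proof (rule clinear_contractionI)
  show "norm (const_bcontfun a :: 'x \<Rightarrow>\<^sub>C 'a) \<le> norm a" for a
    by (intro norm_bound) simp
qed (auto intro!: bcontfun_eqI simp: scaleC_bcontfun.rep_eq)

lemma fscale_times:
  "fscale g p * q = fscale g (p * q)" "p * fscale g q = fscale g (p * q)"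
  by (auto intro!: bcontfun_eqI
      simp: fscale.rep_eq times_bcontfun.rep_eq mult_scaleC_left mult_scaleC_right)

lemma fscale_commute: "fscale g (fscale h p) = fscale h (fscale g p)"
  by (auto intro!: bcontfun_eqI simp: fscale.rep_eq scaleC_scaleC mult.commute)

lemma fscale_cnj:
  assumes "unimodular g"
  shows "fscale g (fscale (bcontfun_cnj g) p) = p" "fscale (bcontfun_cnj g) (fscale g p) = p"
proof -
  have "apply_bcontfun g x * cnj (apply_bcontfun g x) = 1" for x
    using assms complex_norm_square[of "apply_bcontfun g x"] by (simp add: unimodular_def)
  then have "apply_bcontfun g x *\<^sub>C cnj (apply_bcontfun g x) *\<^sub>C y = y"
    "cnj (apply_bcontfun g x) *\<^sub>C apply_bcontfun g x *\<^sub>C y = y" for x and y :: 'b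
    by (simp_all add: scaleC_scaleC scaleC_one mult.commute[of "cnj (apply_bcontfun g x)"])
  then show "fscale g (fscale (bcontfun_cnj g) p) = p" "fscale (bcontfun_cnj g) (fscale g p) = p"
    by (auto intro!: bcontfun_eqI simp: fscale.rep_eq bcontfun_cnj.rep_eq)
qed

lemma const_bcontfun_times:
  "const_bcontfun a * const_bcontfun b = const_bcontfun (a * b)"
  by (auto intro!: bcontfun_eqI simp: times_bcontfun.rep_eq)

text \<open>For unimodular \<open>g\<close> this is \<open>p \<otimes> q \<mapsto> g p \<otimes> g\<^sup>* q\<close> with \<open>g\<^sup>*\<close> the conjugate of \<open>g\<close>: conjugation by the
  unitary \<open>g\<close>. An element fixed by it commutes with \<open>g\<close>, since \<open>g\<^sup>* = g\<^sup>-\<^sup>1\<close>.\<close>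
definition rotate ::
  "('x::topological_space \<Rightarrow>\<^sub>C complex) \<Rightarrow> ('x \<Rightarrow>\<^sub>C 'a::complex_banach_algebra, 'x \<Rightarrow>\<^sub>C 'a) ptensor
    \<Rightarrow> ('x \<Rightarrow>\<^sub>C 'a, 'x \<Rightarrow>\<^sub>C 'a) ptensor" where
  "rotate g = ptensor_map (fscale g) (fscale (bcontfun_cnj g))"

definition const_ptensor ::
  "('a::complex_banach_algebra, 'a) ptensor \<Rightarrow> ('x::topological_space \<Rightarrow>\<^sub>C 'a, 'x \<Rightarrow>\<^sub>C 'a) ptensor"
  where "const_ptensor = ptensor_map const_bcontfun const_bcontfun"

lemmas ptensor_pure = ptensor_map_pure ptensor_lmult_of ptensor_rmult_of product_map_of
  tensor_lmult_pure tensor_rmult_pure tensor_prod_pure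

lemma bounded_linear_const_ptensor: "bounded_linear const_ptensor"
  unfolding const_ptensor_def by (intro bounded_linear_ptensor_map clinear_contraction_const)

lemma const_ptensor_pure:
  "const_ptensor (ptensor_of (a \<otimes>\<^sub>t b)) = ptensor_of (const_bcontfun a \<otimes>\<^sub>t const_bcontfun b)"
  unfolding const_ptensor_def by (intro ptensor_map_pure clinear_contraction_const)

lemma product_map_const_ptensor:
  fixes u :: "('a::complex_banach_algebra, 'a) ptensor"
  shows "product_map (const_ptensor u) =
    (const_bcontfun (product_map u) :: 'x::topological_space \<Rightarrow>\<^sub>C 'a)"
proof -
  have "bounded_linear (const_bcontfun :: 'a \<Rightarrow> 'x \<Rightarrow>\<^sub>C 'a)"
    using clinear_contraction_const
    by (intro bounded_linear_intro[where K = 1]) (auto simp: clinear_contraction_def scaleR_scaleC)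
  then have "bounded_linear (\<lambda>u. const_bcontfun (product_map u) :: 'x \<Rightarrow>\<^sub>C 'a)"
    by (rule bounded_linear_compose) (rule bounded_linear_product_map)
  from ptensor_bounded_linear_eqI[OF bounded_linear_compose[OF bounded_linear_product_map bounded_linear_const_ptensor] this]
  show ?thesis by (simp add: const_ptensor_pure ptensor_pure const_bcontfun_times)
qed

lemma const_ptensor_lmult:
  "const_bcontfun a \<bullet>\<^sub>l const_ptensor u = const_ptensor (a \<bullet>\<^sub>l u)"
  by (rule ptensor_bounded_linear_eqI[OF bounded_linear_compose[OF bounded_linear_ptensor_lmult bounded_linear_const_ptensor]
        bounded_linear_compose[OF bounded_linear_const_ptensor bounded_linear_ptensor_lmult]])
    (simp add: const_ptensor_pure ptensor_pure const_bcontfun_times)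

lemma const_ptensor_rmult:
  "const_ptensor u \<bullet>\<^sub>r const_bcontfun a = const_ptensor (u \<bullet>\<^sub>r a)"
  by (rule ptensor_bounded_linear_eqI[OF bounded_linear_compose[OF bounded_linear_ptensor_rmult bounded_linear_const_ptensor]
        bounded_linear_compose[OF bounded_linear_const_ptensor bounded_linear_ptensor_rmult]])
    (simp add: const_ptensor_pure ptensor_pure const_bcontfun_times)

lemma
  assumes g: "unimodular g"
  shows bounded_linear_rotate: "bounded_linear (rotate g)"
    and norm_rotate: "norm (rotate g v) \<le> norm v"
    and rotate_pure:
      "rotate g (ptensor_of (p \<otimes>\<^sub>t q)) = ptensor_of (fscale g p \<otimes>\<^sub>t fscale (bcontfun_cnj g) q)"
  unfolding rotate_def
  by (simp_all add: bounded_linear_ptensor_map norm_ptensor_map ptensor_map_pure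
      clinear_contraction_fscale unimodular_cnj g)

lemma rotate_commute:
  assumes "unimodular g" "unimodular h"
  shows "rotate g (rotate h v) = rotate h (rotate g v)"
  by (rule ptensor_bounded_linear_eqI[OF
        bounded_linear_compose[OF bounded_linear_rotate[OF assms(1)] bounded_linear_rotate[OF assms(2)]]
        bounded_linear_compose[OF bounded_linear_rotate[OF assms(2)] bounded_linear_rotate[OF assms(1)]]])
    (simp add: rotate_pure assms fscale_commute)

context
  fixes g :: "'x::topological_space \<Rightarrow>\<^sub>C complex"
  assumes g: "unimodular g"
begin

lemmas rotate_lin = bounded_linear_rotate[OF g]

lemma product_map_rotate: "product_map (rotate g v) = product_map v"
  by (rule ptensor_bounded_linear_eqI[OF bounded_linear_compose[OF bounded_linear_product_map rotate_lin]
        bounded_linear_product_map])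
    (simp add: rotate_pure[OF g] ptensor_pure fscale_times fscale_cnj g)

lemma rotate_const_lmult:
  "const_bcontfun a \<bullet>\<^sub>l rotate g v = rotate g (const_bcontfun a \<bullet>\<^sub>l v)"
  by (rule ptensor_bounded_linear_eqI[OF bounded_linear_compose[OF bounded_linear_ptensor_lmult rotate_lin]
        bounded_linear_compose[OF rotate_lin bounded_linear_ptensor_lmult]])
    (simp add: rotate_pure[OF g] ptensor_pure fscale_times)

lemma rotate_const_rmult:
  "rotate g v \<bullet>\<^sub>r const_bcontfun a = rotate g (v \<bullet>\<^sub>r const_bcontfun a)"
  by (rule ptensor_bounded_linear_eqI[OF bounded_linear_compose[OF bounded_linear_ptensor_rmult rotate_lin]
        bounded_linear_compose[OF rotate_lin bounded_linear_ptensor_rmult]])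
    (simp add: rotate_pure[OF g] ptensor_pure fscale_times)

text \<open>Write \<open>L\<close> and \<open>R\<close> for multiplication by \<open>g\<close> in the first and in the second tensor factor. As \<open>a\<close>
  commutes with \<open>v\<close>, the commutator of \<open>g a\<close> with \<open>v\<close> is \<open>(L - R)(v \<cdot> a)\<close>, and \<open>L\<close> is \<open>R\<close> after the
  rotation by \<open>g\<close>. So it is controlled by how far the rotation moves \<open>v\<close>.\<close>
lemma norm_commutator_le:
  fixes v :: "('x \<Rightarrow>\<^sub>C 'a::complex_banach_algebra, 'x \<Rightarrow>\<^sub>C 'a) ptensor"
  assumes central: "const_bcontfun a \<bullet>\<^sub>l v = v \<bullet>\<^sub>r const_bcontfun a"
  shows "norm (fscale g (const_bcontfun a) \<bullet>\<^sub>l v - v \<bullet>\<^sub>r fscale g (const_bcontfun a))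
    \<le> norm a * norm (rotate g v - v)"
proof -
  let ?a = "const_bcontfun a :: 'x \<Rightarrow>\<^sub>C 'a" and ?R = "ptensor_map (\<lambda>p. p) (fscale g)"
  interpret R: bounded_linear ?R by (intro bounded_linear_ptensor_map clinear_contraction_id clinear_contraction_fscale g)
  interpret a: bounded_linear "\<lambda>u. u \<bullet>\<^sub>r ?a" by (rule bounded_linear_ptensor_rmult)
  have "fscale g ?a \<bullet>\<^sub>l v = ?R (rotate g (?a \<bullet>\<^sub>l v))"
    by (rule ptensor_bounded_linear_eqI[OF bounded_linear_ptensor_lmult
          bounded_linear_compose[OF R.bounded_linear
            bounded_linear_compose[OF rotate_lin bounded_linear_ptensor_lmult]]])
      (simp add: ptensor_pure clinear_contraction_id clinear_contraction_fscale g rotate_pure[OF g] fscale_times fscale_cnj g)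
  moreover have "v \<bullet>\<^sub>r fscale g ?a = ?R (v \<bullet>\<^sub>r ?a)"
    by (rule ptensor_bounded_linear_eqI[OF bounded_linear_ptensor_rmult
          bounded_linear_compose[OF R.bounded_linear bounded_linear_ptensor_rmult]])
      (simp add: ptensor_pure clinear_contraction_id clinear_contraction_fscale g fscale_times)
  ultimately have "fscale g ?a \<bullet>\<^sub>l v - v \<bullet>\<^sub>r fscale g ?a = ?R ((rotate g v - v) \<bullet>\<^sub>r ?a)"
    by (simp add: central rotate_const_rmult R.diff a.diff)
  also have "norm \<dots> \<le> norm ((rotate g v - v) \<bullet>\<^sub>r ?a)"
    by (intro norm_ptensor_map clinear_contraction_id clinear_contraction_fscale g)
  also have "\<dots> \<le> norm ?a * norm (rotate g v - v)" by (rule norm_ptensor_rmult)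
  also have "\<dots> \<le> norm a * norm (rotate g v - v)"
    using clinear_contraction_const by (intro mult_right_mono) (auto simp: clinear_contraction_def)
  finally show ?thesis .
qed

end

section \<open>Almost invariant elements\<close>

text \<open>Convergence along this filter means: for all \<open>v\<close> in \<open>C\<close> that are moved sufficiently little by
  sufficiently many (but finitely many) rotations.\<close>
definition almost_invariant ::
  "('x::topological_space \<Rightarrow>\<^sub>C 'a::complex_banach_algebra, 'x \<Rightarrow>\<^sub>C 'a) ptensor set
    \<Rightarrow> ('x \<Rightarrow>\<^sub>C 'a, 'x \<Rightarrow>\<^sub>C 'a) ptensor filter" where
  "almost_invariant C = (INF (g, e)\<in>{(g, e). unimodular g \<and> 0 < e}.
    principal {v \<in> C. norm (rotate g v - v) < e})"

lemma eventually_almost_invariant: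
  assumes "unimodular g" "0 < e"
  shows "\<forall>\<^sub>F v in almost_invariant C. v \<in> C \<and> norm (rotate g v - v) < e"
proof -
  have "almost_invariant C \<le> principal {v \<in> C. norm (rotate g v - v) < e}"
    unfolding almost_invariant_def by (rule INF_lower2[of "(g, e)"]) (use assms in auto)
  then show ?thesis by (auto simp: le_principal)
qed

lemma eventually_almost_invariant_mem: "\<forall>\<^sub>F v in almost_invariant C. v \<in> C"
proof -
  \<comment> \<open>The constant function one serves as a witness that the filter has at least one generator.\<close>
  have "unimodular (const_bcontfun 1)" by (simp add: unimodular_def)
  from eventually_almost_invariant[OF this zero_less_one] show ?thesis
    by (rule eventually_mono) simp
qed

text \<open>Rotations commute with each other because scalar functions do, so approximate common fixed
  points exist.\<close>
lemma almost_invariant_neq_bot: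
  assumes "C \<noteq> {}" "convex C" "bounded C"
    and inv: "\<And>g v. unimodular g \<Longrightarrow> v \<in> C \<Longrightarrow> rotate g v \<in> C"
  shows "almost_invariant C \<noteq> bot"
  unfolding almost_invariant_def
proof (rule INF_filter_not_bot)
  fix X :: "(('a \<Rightarrow>\<^sub>C complex) \<times> real) set"
  assume X: "X \<subseteq> {(g, e). unimodular g \<and> 0 < e}" "finite X"
  define d where "d = Min (insert 1 (snd ` X))"
  have "d > 0" unfolding d_def using X by (subst Min_gr_iff) auto
  have d: "d \<le> e" if "(g, e) \<in> X" for g e
    unfolding d_def by (rule Min_le) (use that X(2) in force)+
  have unim: "unimodular g" if "g \<in> fst ` X" for g using X(1) that by auto
  have "\<exists>v\<in>C. \<forall>T\<in>rotate ` fst ` X. norm (T v - v) < d"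
  proof (rule approximate_common_fixed_point[OF _ assms(1-3) _ _ _ \<open>d > 0\<close>])
    show "linear T" if "T \<in> rotate ` fst ` X" for T
      using that unim bounded_linear.linear[OF bounded_linear_rotate] by blast
    show "S (T v) = T (S v)" if "S \<in> rotate ` fst ` X" "T \<in> rotate ` fst ` X" for S T v
      using that unim rotate_commute by blast
    show "T v \<in> C" if "T \<in> rotate ` fst ` X" "v \<in> C" for T v
      using that unim inv by blast
  qed (use X in simp)
  then obtain v where v: "v \<in> C" "\<And>g e. (g, e) \<in> X \<Longrightarrow> norm (rotate g v - v) < d"
    by force
  have "v \<in> (\<Inter>(g, e)\<in>X. {v \<in> C. norm (rotate g v - v) < e})"
    using v d by (fastforce intro: less_le_trans)
  then show "(INF (g, e)\<in>X. principal {v \<in> C. norm (rotate g v - v) < e}) \<noteq> bot"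
    using INF_principal_finite[OF X(2), of "\<lambda>(g, e). {v \<in> C. norm (rotate g v - v) < e}"]
    by (auto simp: case_prod_unfold principal_eq_bot_iff)
qed

section \<open>Combinations of scalar functions and constants\<close>

text \<open>A real number \<open>t\<close> in the unit interval is the real part of \<open>t + \<i> \<surd>(1 - t\<^sup>2)\<close>, which lies on the unit
  circle.\<close>
lemma unit_interval_average_of_unimodular:
  assumes "\<And>x. apply_bcontfun h x \<in> complex_of_real ` {0..1}"
  obtains g where "unimodular g"
    "\<And>x. apply_bcontfun h x = (apply_bcontfun g x + cnj (apply_bcontfun g x)) / 2"
proof
  let ?h = "\<lambda>x. Re (apply_bcontfun h x)"
  let ?g = "\<lambda>x. Complex (?h x) (sqrt (1 - (?h x)\<^sup>2))"
  have h: "apply_bcontfun h x = complex_of_real (?h x)" "0 \<le> ?h x" "?h x \<le> 1" for x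
    using assms[of x] by auto
  then have norm: "cmod (?g x) = 1" for x
    by (simp add: complex_norm power_le_one)
  have "continuous_on UNIV ?g"
    unfolding Complex_eq by (intro continuous_intros continuous_on_apply_bcontfun)
  then have "?g \<in> bcontfun" by (rule bcontfun_normI[where b = 1]) (simp add: norm)
  then have g: "apply_bcontfun (Bcontfun ?g) = ?g" by (rule Bcontfun_inverse)
  show "unimodular (Bcontfun ?g)" by (simp add: unimodular_def g norm)
  show "apply_bcontfun h x = (apply_bcontfun (Bcontfun ?g) x + cnj (apply_bcontfun (Bcontfun ?g) x)) / 2"
    for x by (subst h(1)) (simp add: g complex_eq_iff)
qed

text \<open>A partition of unity that suits \<open>f\<close> can be pulled back from the metric space of values: cover
  the compact range of \<open>f\<close> by finitely many balls and compose tent functions around their centres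
  with \<open>f\<close>. In a common ball \<open>f x\<close> is within \<open>d\<close> of the centre, so the weighted mean of the centres is
  within \<open>d\<close> of \<open>f x\<close>.\<close>
lemma unit_interval_combinations_dense:
  fixes f :: "'x::topological_space \<Rightarrow>\<^sub>C 'a::complex_banach_algebra"
  assumes "compact (UNIV :: 'x set)" "0 < d"
  obtains A h where "finite A"
    "\<And>a x. a \<in> A \<Longrightarrow> apply_bcontfun (h a) x \<in> complex_of_real ` {0..1}"
    "norm (f - (\<Sum>a\<in>A. fscale (h a) (const_bcontfun a))) \<le> d"
proof -
  have cont: "continuous_on UNIV (apply_bcontfun f)" by simp
  have "compact (range (apply_bcontfun f))"
    by (rule compact_continuous_image[OF cont assms(1)])
  then obtain A where A: "finite A" "range (apply_bcontfun f) \<subseteq> (\<Union>a\<in>A. ball a d)"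
    using \<open>0 < d\<close> unfolding compact_eq_totally_bounded by meson
  define b where "b = (\<lambda>a x. max 0 (d - norm (apply_bcontfun f x - a)))"
  define s where "s = (\<lambda>x. \<Sum>a\<in>A. b a x)"
  have b0: "0 \<le> b a x" for a x by (simp add: b_def)
  have s0: "0 < s x" for x
  proof -
    obtain a where "a \<in> A" "apply_bcontfun f x \<in> ball a d" using A(2) by blast
    then have "0 < b a x" by (simp add: b_def dist_norm norm_minus_commute)
    then show ?thesis unfolding s_def using \<open>a \<in> A\<close> A(1) b0 by (intro sum_pos2)
  qed
  have bs: "b a x \<le> s x" if "a \<in> A" for a x
    unfolding s_def using that A(1) b0 by (intro member_le_sum)
  have b_cont: "continuous_on UNIV (b a)" for a
    unfolding b_def by (intro continuous_intros continuous_on_apply_bcontfun)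
  have s_cont: "continuous_on UNIV s"
    unfolding s_def by (intro continuous_intros b_cont)
  let ?h = "\<lambda>a x. complex_of_real (b a x / s x)"
  have h_bcont: "?h a \<in> bcontfun" if "a \<in> A" for a
  proof (rule bcontfun_normI[where b = 1])
    show "continuous_on UNIV (?h a)"
      using s0 by (intro continuous_intros b_cont s_cont) (metis less_irrefl)
    show "norm (?h a x) \<le> 1" for x
      using b0[of a x] s0[of x] bs[OF that, of x] by (simp del: of_real_divide)
  qed
  define h where "h = (\<lambda>a. Bcontfun (?h a))"
  have h: "apply_bcontfun (h a) x = ?h a x" if "a \<in> A" for a x
    unfolding h_def using Bcontfun_inverse[OF h_bcont[OF that]] by simp
  show thesis
  proof (rule that[of A h])
    fix a x assume "a \<in> A"
    then show "apply_bcontfun (h a) x \<in> complex_of_real ` {0..1}"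
      using b0[of a x] s0[of x] bs[of a x] by (simp add: h del: of_real_divide)
  next
    show "norm (f - (\<Sum>a\<in>A. fscale (h a) (const_bcontfun a))) \<le> d"
    proof (rule norm_bound)
      fix x
      let ?y = "apply_bcontfun f x"
      have app_sum: "apply_bcontfun (sum F B) x = (\<Sum>a\<in>B. apply_bcontfun (F a) x)"
        for F :: "'a \<Rightarrow> 'x \<Rightarrow>\<^sub>C 'a" and B
        by (induction B rule: infinite_finite_induct) auto
      have one: "(\<Sum>a\<in>A. b a x / s x) = 1"
        using s0[of x] by (simp add: s_def flip: sum_divide_distrib)
      have "apply_bcontfun (f - (\<Sum>a\<in>A. fscale (h a) (const_bcontfun a))) x
          = (\<Sum>a\<in>A. b a x / s x) *\<^sub>R ?y - (\<Sum>a\<in>A. (b a x / s x) *\<^sub>R a)"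
        by (simp add: one app_sum fscale.rep_eq h scaleR_scaleC scaleC_one cong: sum.cong)
      also have "\<dots> = (\<Sum>a\<in>A. (b a x / s x) *\<^sub>R (?y - a))"
        by (simp add: scaleR_sum_left sum_subtractf scaleR_diff_right)
      also have "norm \<dots> \<le> (\<Sum>a\<in>A. b a x / s x * d)"
      proof (rule sum_norm_le)
        fix a assume "a \<in> A"
        show "norm ((b a x / s x) *\<^sub>R (?y - a)) \<le> b a x / s x * d"
        \<comment> \<open>Outside the ball of radius \<open>d\<close> around \<open>a\<close> the weight of \<open>a\<close> vanishes.\<close>
        proof (cases "norm (?y - a) < d")
          case True
          then show ?thesis
            using b0[of a x] s0[of x] by (simp add: mult_left_mono divide_right_mono)
        next
          case False
          then have "b a x = 0" by (simp add: b_def)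
          then show ?thesis by simp
        qed
      qed
      also have "\<dots> = d" by (simp only: one mult_1_left flip: sum_distrib_right)
      finally show "norm (apply_bcontfun (f - (\<Sum>a\<in>A. fscale (h a) (const_bcontfun a))) x) \<le> d" .
    qed
  qed (rule A(1))
qed

section \<open>Commutators with almost invariant elements\<close>

lemma ptensor_lmult_add_left: "(a + b) \<bullet>\<^sub>l v = a \<bullet>\<^sub>l v + b \<bullet>\<^sub>l v"
  by (rule ptensor_bounded_linear_eqI[OF bounded_linear_ptensor_lmult
        bounded_linear_add[OF bounded_linear_ptensor_lmult bounded_linear_ptensor_lmult]])
    (simp add: ptensor_pure distrib_right pure_tensor_bilinear ptensor_of_add)

lemma ptensor_rmult_add_right: "v \<bullet>\<^sub>r (a + b) = v \<bullet>\<^sub>r a + v \<bullet>\<^sub>r b"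
  by (rule ptensor_bounded_linear_eqI[OF bounded_linear_ptensor_rmult
        bounded_linear_add[OF bounded_linear_ptensor_rmult bounded_linear_ptensor_rmult]])
    (simp add: ptensor_pure distrib_left pure_tensor_bilinear ptensor_of_add)

definition commutator ::
  "'b::complex_banach_algebra \<Rightarrow> ('b, 'b) ptensor \<Rightarrow> ('b, 'b) ptensor" where
  "commutator a v = a \<bullet>\<^sub>l v - v \<bullet>\<^sub>r a"

lemma commutator_add: "commutator (a + b) v = commutator a v + commutator b v"
  by (simp add: commutator_def ptensor_lmult_add_left ptensor_rmult_add_right)

lemma commutator_diff: "commutator (a - b) v = commutator a v - commutator b v"
  using commutator_add[of "a - b" b v] by (simp add: algebra_simps)

lemma norm_commutator: "norm (commutator a v) \<le> 2 * norm a * norm v"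
  using norm_triangle_ineq4[of "a \<bullet>\<^sub>l v" "v \<bullet>\<^sub>r a"] norm_ptensor_lmult[of a v]
    norm_ptensor_rmult[of v a]
  by (simp add: commutator_def)

text \<open>The functions \<open>f\<close> with this property form a closed subspace: here it matters that \<open>C\<close> is bounded,
  so that the bound on the commutators is uniform over \<open>C\<close>. The subspace contains \<open>g a\<close> for unimodular
  \<open>g\<close> and constant \<open>a\<close>, hence \<open>h a\<close> for \<open>h\<close> with values in the unit interval, and these span a
  dense subspace.\<close>
lemma commutator_tendsto_0:
  fixes f :: "'x::topological_space \<Rightarrow>\<^sub>C 'a::complex_banach_algebra"
  assumes cpt: "compact (UNIV :: 'x set)"
    and R: "\<And>v. v \<in> C \<Longrightarrow> norm v \<le> R"
    and central: "\<And>v a. v \<in> C \<Longrightarrow> const_bcontfun a \<bullet>\<^sub>l v = v \<bullet>\<^sub>r const_bcontfun a"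
  shows "(commutator f \<longlongrightarrow> 0) (almost_invariant C)"
proof -
  have unimod: "(commutator (fscale g (const_bcontfun a)) \<longlongrightarrow> 0) (almost_invariant C)"
    if g: "unimodular g" for g and a :: 'a
  proof (rule tendsto_0_le[where K = "norm a"])
    show "((\<lambda>v. rotate g v - v) \<longlongrightarrow> 0) (almost_invariant C)"
      unfolding tendsto_iff
      by (auto elim!: eventually_mono[OF eventually_almost_invariant[OF g]])
    show "\<forall>\<^sub>F v in almost_invariant C.
        norm (commutator (fscale g (const_bcontfun a)) v) \<le> norm (rotate g v - v) * norm a"
      by (rule eventually_mono[OF eventually_almost_invariant_mem])
        (use norm_commutator_le[OF g central] in \<open>simp add: commutator_def mult.commute\<close>)
  qed
  have unit: "(commutator (fscale h (const_bcontfun a)) \<longlongrightarrow> 0) (almost_invariant C)"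
    if h: "\<And>x. apply_bcontfun h x \<in> complex_of_real ` {0..1}" for h and a :: 'a
  proof -
    obtain g where g: "unimodular g"
      "\<And>x. apply_bcontfun h x = (apply_bcontfun g x + cnj (apply_bcontfun g x)) / 2"
      using h by (rule unit_interval_average_of_unimodular) blast
    let ?a = "const_bcontfun ((1 / 2) *\<^sub>C a) :: 'x \<Rightarrow>\<^sub>C 'a"
    have "fscale h (const_bcontfun a) = fscale g ?a + fscale (bcontfun_cnj g) ?a"
      by (auto intro!: bcontfun_eqI
          simp: fscale.rep_eq bcontfun_cnj.rep_eq g(2) scaleC_scaleC simp flip: scaleC_add_left)
        (simp add: add_divide_distrib)
    then have "commutator (fscale h (const_bcontfun a)) =
        (\<lambda>v. commutator (fscale g ?a) v + commutator (fscale (bcontfun_cnj g) ?a) v)"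
      by (auto simp: commutator_add)
    then show ?thesis
      using tendsto_add[OF unimod[OF g(1)] unimod[OF unimodular_cnj[OF g(1)]]] by simp
  qed
  have sum: "(commutator (\<Sum>a\<in>A. fscale (h a) (const_bcontfun a)) \<longlongrightarrow> 0) (almost_invariant C)"
    if "finite A" "\<And>a x. a \<in> A \<Longrightarrow> apply_bcontfun (h a) x \<in> complex_of_real ` {0..1}"
    for A :: "'a set" and h
    using that
  proof (induction A rule: finite_induct)
    case empty
    have "commutator 0 = (\<lambda>v :: ('x \<Rightarrow>\<^sub>C 'a, 'x \<Rightarrow>\<^sub>C 'a) ptensor. 0)"
      using commutator_diff[of 0 0] by auto
    then show ?case by simp
  next
    case (insert a A)
    have "commutator (\<Sum>a\<in>insert a A. fscale (h a) (const_bcontfun a)) =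
      (\<lambda>v. commutator (fscale (h a) (const_bcontfun a)) v
        + commutator (\<Sum>a\<in>A. fscale (h a) (const_bcontfun a)) v)"
      using insert.hyps by (auto simp: commutator_add)
    then show ?case
      using tendsto_add[OF unit insert.IH] insert.prems by simp
  qed
  show ?thesis
    unfolding tendsto_iff
  proof (intro allI impI)
    fix e :: real assume "0 < e"
    define d where "d = e / (4 * (\<bar>R\<bar> + 1))"
    have "0 < d" using \<open>0 < e\<close> by (simp add: d_def)
    obtain A h where A: "finite A"
      "\<And>a x. a \<in> A \<Longrightarrow> apply_bcontfun (h a) x \<in> complex_of_real ` {0..1}"
      "norm (f - (\<Sum>a\<in>A. fscale (h a) (const_bcontfun a))) \<le> d"
      using unit_interval_combinations_dense[OF cpt \<open>0 < d\<close>, of f] by blast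
    let ?p = "\<Sum>a\<in>A. fscale (h a) (const_bcontfun a)"
    have "\<forall>\<^sub>F v in almost_invariant C. dist (commutator ?p v) 0 < e / 2"
      using sum[OF A(1,2)] \<open>0 < e\<close> by (intro tendstoD) auto
    then show "\<forall>\<^sub>F v in almost_invariant C. dist (commutator f v) 0 < e"
      using eventually_almost_invariant_mem
    proof eventually_elim
      case (elim v)
      have "norm (commutator (f - ?p) v) \<le> 2 * norm (f - ?p) * norm v"
        by (rule norm_commutator)
      also have "\<dots> \<le> 2 * d * (\<bar>R\<bar> + 1)"
        using A(3) R[OF elim(2)] \<open>0 < d\<close> by (intro mult_mono) auto
      also have "\<dots> = e / 2" by (simp add: d_def field_simps)
      finally have "norm (commutator f v - commutator ?p v) \<le> e / 2"
        by (simp add: commutator_diff)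
      then show ?case
        using elim(1) norm_triangle_sub[of "commutator f v" "commutator ?p v"] by simp
    qed
  qed
qed

text \<open>Uniformity over a compact set follows from a finite net, again because \<open>C\<close> is bounded.\<close>
lemma eventually_commutator_less_compact:
  fixes K :: "('x::topological_space \<Rightarrow>\<^sub>C 'a::complex_banach_algebra) set"
  assumes cpt: "compact (UNIV :: 'x set)"
    and R: "\<And>v. v \<in> C \<Longrightarrow> norm v \<le> R"
    and central: "\<And>v a. v \<in> C \<Longrightarrow> const_bcontfun a \<bullet>\<^sub>l v = v \<bullet>\<^sub>r const_bcontfun a"
    and "compact K" "0 < e"
  shows "\<forall>\<^sub>F v in almost_invariant C. \<forall>f\<in>K. norm (commutator f v) < e"
proof -
  define d where "d = e / (4 * (\<bar>R\<bar> + 1))"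
  have "0 < d" using \<open>0 < e\<close> by (simp add: d_def)
  then obtain N where N: "finite N" "K \<subseteq> (\<Union>p\<in>N. ball p d)"
    using \<open>compact K\<close> unfolding compact_eq_totally_bounded by meson
  have "\<forall>\<^sub>F v in almost_invariant C. \<forall>p\<in>N. dist (commutator p v) 0 < e / 2"
  proof (intro eventually_ball_finite N(1) ballI tendstoD)
    show "(commutator p \<longlongrightarrow> 0) (almost_invariant C)" for p
      by (rule commutator_tendsto_0[OF cpt R central])
  qed (use \<open>0 < e\<close> in simp)
  then show ?thesis
    using eventually_almost_invariant_mem
  proof eventually_elim
    case (elim v)
    show ?case
    proof
      fix f assume "f \<in> K"
      then obtain p where p: "p \<in> N" "dist p f < d" using N(2) by auto
      have "norm (commutator (f - p) v) \<le> 2 * norm (f - p) * norm v"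
        by (rule norm_commutator)
      also have "\<dots> \<le> 2 * d * (\<bar>R\<bar> + 1)"
        using p(2) R[OF elim(2)] \<open>0 < d\<close>
        by (intro mult_mono) (auto simp: dist_norm norm_minus_commute)
      also have "\<dots> = e / 2" by (simp add: d_def field_simps)
      finally have "norm (commutator f v - commutator p v) \<le> e / 2"
        by (simp add: commutator_diff)
      moreover have "norm (commutator p v) < e / 2" using elim(1) p(1) by simp
      ultimately show "norm (commutator f v) < e"
        using norm_triangle_sub[of "commutator f v" "commutator p v"] by simp
    qed
  qed
qed

section \<open>Existence of the diagonal\<close>

text \<open>Evaluation is jointly continuous for the supremum norm.\<close>
lemma compact_values:
  fixes K :: "('x::topological_space \<Rightarrow>\<^sub>C 'a::metric_space) set"
  assumes "compact (UNIV :: 'x set)" "compact K"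
  shows "compact ((\<lambda>(f, x). apply_bcontfun f x) ` (K \<times> UNIV))"
proof (rule compact_continuous_image[OF _ compact_Times[OF assms(2,1)]])
  show "continuous_on (K \<times> UNIV) (\<lambda>(f, x). apply_bcontfun f x)"
    unfolding continuous_on_def
  proof clarify
    fix f :: "'x \<Rightarrow>\<^sub>C 'a" and x :: 'x
    let ?F = "at (f, x) within K \<times> UNIV"
    have "(snd \<longlongrightarrow> x) ?F" "(fst \<longlongrightarrow> f) ?F"
      using tendsto_snd[OF tendsto_ident_at, of "(f, x)"] tendsto_fst[OF tendsto_ident_at, of "(f, x)"]
      by auto
    then have "((\<lambda>p. dist (fst p) f) \<longlongrightarrow> 0) ?F"
      "((\<lambda>p. apply_bcontfun f (snd p)) \<longlongrightarrow> apply_bcontfun f x) ?F"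
      using continuous_on_tendsto_compose[OF continuous_on_apply_bcontfun[of UNIV f]]
      by (simp_all flip: tendsto_dist_iff)
    then have "((\<lambda>p. dist (fst p) f + dist (apply_bcontfun f (snd p)) (apply_bcontfun f x)) \<longlongrightarrow> 0) ?F"
      by (intro tendsto_add_zero) (simp_all flip: tendsto_dist_iff)
    then have "((\<lambda>p. dist (apply_bcontfun (fst p) (snd p)) (apply_bcontfun f x)) \<longlongrightarrow> 0) ?F"
      by (rule tendsto_sandwich[OF _ _ tendsto_const, rotated 2])
        (auto intro!: always_eventually order_trans[OF dist_triangle add_right_mono[OF dist_bounded]])
    then show "((\<lambda>(f, x). apply_bcontfun f x) \<longlongrightarrow> apply_bcontfun f x) ?F"
      by (simp add: case_prod_unfold flip: tendsto_dist_iff)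
  qed
qed

text \<open>One good element for each compact set and each tolerance is enough: these pairs, ordered by
  increasing demands, index the net.\<close>
lemma compactly_approximate_diagonal_existsI:
  assumes "\<And>(K :: 'b::complex_banach_algebra set) e. compact K \<Longrightarrow> e > 0 \<Longrightarrow>
    \<exists>v. \<forall>a\<in>K. norm (a \<bullet>\<^sub>l v - v \<bullet>\<^sub>r a) < e \<and> norm (product_map v * a - a) < e"
  shows "\<exists>(J :: ('b set \<times> real) set) le'
    (v :: 'b set \<times> real \<Rightarrow> ('b, 'b) ptensor).
    compactly_approximate_diagonal J le' v"
proof -
  have "\<forall>K e. \<exists>v. compact K \<longrightarrow> e > 0 \<longrightarrow>
      (\<forall>a\<in>K. norm (a \<bullet>\<^sub>l v - v \<bullet>\<^sub>r a) < e \<and> norm (product_map v * a - (a::'b)) < e)"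
    using assms by blast
  then obtain v where v: "\<And>(K :: 'b set) e a. compact K \<Longrightarrow> e > 0 \<Longrightarrow> a \<in> K \<Longrightarrow>
      norm (a \<bullet>\<^sub>l v K e - v K e \<bullet>\<^sub>r a) < e \<and> norm (product_map (v K e) * a - a) < e"
    by metis
  define J :: "('b set \<times> real) set" where "J = {(K, e). compact K \<and> e > 0}"
  define le' :: "'b set \<times> real \<Rightarrow> 'b set \<times> real \<Rightarrow> bool"
    where "le' = (\<lambda>(K, e) (K', e'). K \<subseteq> K' \<and> e' \<le> e)"
  have "\<exists>k\<in>J. le' (K, d) k \<and> le' (L, e) k" if "(K, d) \<in> J" "(L, e) \<in> J" for K L d e
    using that by (intro bexI[of _ "(K \<union> L, min d e)"]) (auto simp: J_def le'_def)
  moreover have "({}, 1) \<in> J" by (simp add: J_def)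
  ultimately have "directed_set J le'"
    unfolding directed_set_def by (auto simp: le'_def)
  then have "compactly_approximate_diagonal J le' (\<lambda>(K, e). v K e)"
    unfolding compactly_approximate_diagonal_def
  proof (intro conjI allI impI)
    fix K :: "'b set" and e :: real assume "compact K" "e > 0"
    then have "(K, e) \<in> J" by (simp add: J_def)
    moreover have "norm (a \<bullet>\<^sub>l v L d - v L d \<bullet>\<^sub>r a) < e \<and> norm (product_map (v L d) * a - a) < e"
      if "(L, d) \<in> J" "le' (K, e) (L, d)" "a \<in> K" for L d a
      using v[of L d a] that by (auto simp: J_def le'_def)
    ultimately show "\<exists>i0\<in>J. \<forall>i\<in>J. le' i0 i \<longrightarrow>
        (\<forall>a\<in>K. norm (a \<bullet>\<^sub>l (case i of (K, e) \<Rightarrow> v K e) - (case i of (K, e) \<Rightarrow> v K e) \<bullet>\<^sub>r a) < e \<and>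
          norm (product_map (case i of (K, e) \<Rightarrow> v K e) * a - a) < e)"
      by (intro bexI[of _ "(K, e)"]) auto
  qed
  then show ?thesis by blast
qed

theorem proposition3p1:
  fixes I :: "'i set" and le :: "'i \<Rightarrow> 'i \<Rightarrow> bool"
    and u :: "'i \<Rightarrow> ('a::complex_banach_algebra, 'a) ptensor"
  assumes "compact (UNIV :: 'x::t2_space set)"
    and "central_compactly_approximate_diagonal I le u"
  shows "\<exists>(J :: (('x \<Rightarrow>\<^sub>C 'a) set \<times> real) set) le'
    (v :: ('x \<Rightarrow>\<^sub>C 'a) set \<times> real \<Rightarrow> ('x \<Rightarrow>\<^sub>C 'a, 'x \<Rightarrow>\<^sub>C 'a) ptensor).
    compactly_approximate_diagonal J le' v"
proof (rule compactly_approximate_diagonal_existsI)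
  fix K :: "('x \<Rightarrow>\<^sub>C 'a) set" and e :: real
  assume K: "compact K" and "e > 0"
  let ?V = "(\<lambda>(f, x). apply_bcontfun f x) ` (K \<times> UNIV)"
  note diag = assms(2)[unfolded central_compactly_approximate_diagonal_def
      compactly_approximate_diagonal_def central_net_def]
  obtain i where i: "i \<in> I" and i_le: "\<forall>j\<in>I. le i j \<longrightarrow>
      (\<forall>a\<in>?V. norm (a \<bullet>\<^sub>l u j - u j \<bullet>\<^sub>r a) < e / 2 \<and> norm (product_map (u j) * a - a) < e / 2)"
    using diag compact_values[OF assms(1) K] half_gt_zero[OF \<open>e > 0\<close>] by meson
  define w where "w = u i"
  have "le i i" using diag i by (simp add: directed_set_def)
  with i_le i have w: "norm (product_map w * a - a) < e / 2" if "a \<in> ?V" for a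
    using that unfolding w_def by blast
  have w_central: "a \<bullet>\<^sub>l w = w \<bullet>\<^sub>r a" for a
    using diag i unfolding w_def by simp
  \<comment> \<open>These are the properties of the constant embedding of \<open>w\<close> that survive rotations and convex
    combinations. Together with almost invariance they give what is required of the diagonal.\<close>
  define C :: "('x \<Rightarrow>\<^sub>C 'a, 'x \<Rightarrow>\<^sub>C 'a) ptensor set" where
    "C = {v. norm v \<le> norm w \<and> product_map v = const_bcontfun (product_map w) \<and>
      (\<forall>a. const_bcontfun a \<bullet>\<^sub>l v = v \<bullet>\<^sub>r const_bcontfun a)}"
  have "const_ptensor w \<in> C"
    by (simp add: C_def product_map_const_ptensor const_ptensor_lmult const_ptensor_rmult
        w_central) (simp add: const_ptensor_def norm_ptensor_map clinear_contraction_const)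
  moreover have "convex C"
  proof -
    interpret p: bounded_linear "product_map :: ('x \<Rightarrow>\<^sub>C 'a, 'x \<Rightarrow>\<^sub>C 'a) ptensor \<Rightarrow> 'x \<Rightarrow>\<^sub>C 'a"
      by (rule bounded_linear_product_map)
    have "convex {v. product_map v = (const_bcontfun (product_map w) :: 'x \<Rightarrow>\<^sub>C 'a)}"
      by (auto simp: convex_alt p.add p.scale simp flip: scaleR_add_left)
    moreover have "convex {v. const_bcontfun a \<bullet>\<^sub>l v = v \<bullet>\<^sub>r (const_bcontfun a :: 'x \<Rightarrow>\<^sub>C 'a)}" for a
      by (auto simp: convex_def clinear_ptensor_lmult clinear_ptensor_rmult scaleR_scaleC)
    moreover have "convex {v :: ('x \<Rightarrow>\<^sub>C 'a, 'x \<Rightarrow>\<^sub>C 'a) ptensor. norm v \<le> norm w}"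
      using convex_cball[of "0 :: ('x \<Rightarrow>\<^sub>C 'a, 'x \<Rightarrow>\<^sub>C 'a) ptensor" "norm w"]
      by (simp add: cball_def)
    ultimately show ?thesis
      unfolding C_def Collect_conj_eq Collect_all_eq by (intro convex_Int convex_INT) auto
  qed
  moreover have "bounded C" by (auto simp: C_def bounded_iff)
  moreover have "rotate g v \<in> C" if "unimodular g" "v \<in> C" for g v
    using that order_trans[OF norm_rotate[OF that(1), of v]]
    by (simp add: C_def product_map_rotate rotate_const_lmult rotate_const_rmult)
  ultimately have "almost_invariant C \<noteq> bot"
    by (intro almost_invariant_neq_bot) auto
  moreover have "\<forall>\<^sub>F v in almost_invariant C. \<forall>f\<in>K. norm (commutator f v) < e"
    by (rule eventually_commutator_less_compact[OF assms(1) _ _ K \<open>e > 0\<close>]) (auto simp: C_def)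
  then have "\<forall>\<^sub>F v in almost_invariant C. v \<in> C \<and> (\<forall>f\<in>K. norm (commutator f v) < e)"
    by (rule eventually_conj[OF eventually_almost_invariant_mem])
  ultimately obtain v where "v \<in> C" and v: "\<And>f. f \<in> K \<Longrightarrow> norm (commutator f v) < e"
    using eventually_happens by blast
  have "norm (product_map v * f - f) < e" if "f \<in> K" for f
  proof -
    have "norm (product_map v * f - f) \<le> e / 2"
    proof (rule norm_bound)
      fix x
      have "apply_bcontfun f x \<in> ?V" using that by force
      from w[OF this] show "norm (apply_bcontfun (product_map v * f - f) x) \<le> e / 2"
        using \<open>v \<in> C\<close> by (simp add: C_def times_bcontfun.rep_eq)
    qed
    with \<open>e > 0\<close> show ?thesis by simp
  qed
  with v show "\<exists>v. \<forall>f\<in>K. norm (f \<bullet>\<^sub>l v - v \<bullet>\<^sub>r f) < e \<and> norm (product_map v * f - f) < e"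
    unfolding commutator_def by blast
qed

end
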